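(* Let $K$ be a field of characteristic zero, $x=(x_1,\dots,x_n)$, and let $F\in K[x]^n$ be a cubic Keller map without quadratic terms. Then there exists $\lambda\in K^n$ such that, for each of the maps (a) $G=(F-\lambda x_{n+1}^3,\ x_{n+1})\in K[x,x_{n+1}]^{n+1}$, (b) $G=(F-\lambda x_{n+1}^3,\ x_{n+1},\ x_{n+2}+x_{n+1}^3)\in K[x,x_{n+1},x_{n+2}]^{n+2}$, (c) $G=(F-\lambda x_{n+1}^3,\ x_{n+2}-3x^{\mathsf T}\lambda\, x_{n+1}^2,\ x_{n+1}) = (F,0,0)+\nabla_{x,x_{n+1},x_{n+2}}\big(x_{n+1}x_{n+2}-x^{\mathsf T}\lambda\, x_{n+1}^3\big)$, every $K$-linear combination of the components of $G$ and $1$ which is reducible is already a scalar multiple of $1$. Furthermore, in each case $G$ is a cubic Keller map without quadratic terms, and $F$ is invertible if and only if $G$ is invertible. Additionally: i) if $F$ is linearly conjugate to a Drużkowski map, then so is $G$ in (b); ii) if $\mathcal{J}F$ is symmetric, then so is $\mathcal{J}_{x,x_{n+1},x_{n+2}}G$ for $G$ in (c).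
   Context: $\mathcal{J}$ denotes the Jacobian matrix and $\nabla$ the gradient (column vector of partial derivatives) with respect to the indicated variables; $x^{\mathsf T}\lambda=\sum_i\lambda_ix_i$. A Keller map is a polynomial map $F\in K[x]^m$ in $m$ variables with $\det\mathcal{J}F\in K^{*}$. "Cubic without quadratic terms" means every component has degree at most $3$ and no nonzero terms of degree $2$. A map $G$ is linearly conjugate to $D$ if $D=TG(T^{-1}x)$ for some invertible matrix $T$. A Drużkowski map is a polynomial map of the form $x+(Ax)^{*3}$ with $A$ a square matrix over $K$, where $(v)^{*3}$ denotes the componentwise third power. *)

theory Defs
  imports "HOL-Library.Poly_Mapping" "Jordan_Normal_Form.Determinant"
begin

text \<open>Multivariate polynomials over a field in the variables x_0, x_1, ... (indexed by nat):
  a polynomial is a finitely supported map from monomials (exponent vectors nat =>0 nat)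
  to coefficients.  A polynomial map in m variables is a function nat => poly whose
  components with index < m only involve the variables x_0, ..., x_(m-1).\<close>

type_synonym 'a mpoly = "(nat \<Rightarrow>\<^sub>0 nat) \<Rightarrow>\<^sub>0 'a"

definition Const :: "'a::comm_ring_1 \<Rightarrow> 'a mpoly" where
  "Const c = Poly_Mapping.single 0 c"

definition Var :: "nat \<Rightarrow> 'a::comm_ring_1 mpoly" where
  "Var i = Poly_Mapping.single (Poly_Mapping.single i 1) 1"

definition mdeg :: "(nat \<Rightarrow>\<^sub>0 nat) \<Rightarrow> nat" where
  "mdeg m = (\<Sum>i\<in>Poly_Mapping.keys m. Poly_Mapping.lookup m i)"

definition vars :: "'a::comm_ring_1 mpoly \<Rightarrow> nat set" where
  "vars p = \<Union> (Poly_Mapping.keys ` Poly_Mapping.keys p)"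

text \<open>Substitution p(q_0, q_1, ...).\<close>
definition subst :: "'a::comm_ring_1 mpoly \<Rightarrow> (nat \<Rightarrow> 'a mpoly) \<Rightarrow> 'a mpoly" where
  "subst p q = (\<Sum>m\<in>Poly_Mapping.keys p. Const (Poly_Mapping.lookup p m) *
       (\<Prod>i\<in>Poly_Mapping.keys m. q i ^ Poly_Mapping.lookup m i))"

text \<open>Partial derivative with respect to x_i.\<close>
definition pdiff :: "nat \<Rightarrow> 'a::comm_ring_1 mpoly \<Rightarrow> 'a mpoly" where
  "pdiff i p = (\<Sum>m\<in>Poly_Mapping.keys p.
       Const (of_nat (Poly_Mapping.lookup m i) * Poly_Mapping.lookup p m) *
       (\<Prod>j\<in>Poly_Mapping.keys m. Var j ^ (if j = i then Poly_Mapping.lookup m j - 1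
                                               else Poly_Mapping.lookup m j)))"

definition poly_map :: "nat \<Rightarrow> (nat \<Rightarrow> 'a::comm_ring_1 mpoly) \<Rightarrow> bool" where
  "poly_map m F \<longleftrightarrow> (\<forall>i<m. vars (F i) \<subseteq> {..<m})"

text \<open>Jacobian matrix (i,j) entry = d F_i / d x_j.\<close>
definition jac :: "nat \<Rightarrow> (nat \<Rightarrow> 'a::comm_ring_1 mpoly) \<Rightarrow> 'a mpoly mat" where
  "jac m F = mat m m (\<lambda>(i, j). pdiff j (F i))"

definition keller :: "nat \<Rightarrow> (nat \<Rightarrow> 'a::field mpoly) \<Rightarrow> bool" where
  "keller m F \<longleftrightarrow> poly_map m F \<and> (\<exists>c. c \<noteq> 0 \<and> det (jac m F) = Const c)"

definition cubic_no_quad :: "nat \<Rightarrow> (nat \<Rightarrow> 'a::comm_ring_1 mpoly) \<Rightarrow> bool" where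
  "cubic_no_quad m F \<longleftrightarrow>
     (\<forall>i<m. \<forall>mon\<in>Poly_Mapping.keys (F i). mdeg mon \<le> 3 \<and> mdeg mon \<noteq> 2)"

text \<open>Invertible polynomial map: it has a polynomial inverse.\<close>
definition invertible_pm :: "nat \<Rightarrow> (nat \<Rightarrow> 'a::comm_ring_1 mpoly) \<Rightarrow> bool" where
  "invertible_pm m F \<longleftrightarrow> (\<exists>H. poly_map m H \<and>
      (\<forall>i<m. subst (F i) H = Var i \<and> subst (H i) F = Var i))"

text \<open>F (in m variables) is linearly conjugate to a Druzkowski map x + (Ax)^{*3}:
  T F(T^{-1} x) = x + (Ax)^{*3} for an invertible matrix T (inverse Ti).\<close>
definition lin_conj_druzkowski :: "nat \<Rightarrow> (nat \<Rightarrow> 'a::comm_ring_1 mpoly) \<Rightarrow> bool" where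
  "lin_conj_druzkowski m F \<longleftrightarrow> (\<exists>T Ti A.
      T \<in> carrier_mat m m \<and> Ti \<in> carrier_mat m m \<and> A \<in> carrier_mat m m \<and>
      T * Ti = 1\<^sub>m m \<and> Ti * T = 1\<^sub>m m \<and>
      (\<forall>i<m. (\<Sum>j<m. Const (T $$ (i, j)) *
                 subst (F j) (\<lambda>k. \<Sum>l<m. Const (Ti $$ (k, l)) * Var l))
             = Var i + (\<Sum>j<m. Const (A $$ (i, j)) * Var j) ^ 3))"

definition reducible :: "'a::comm_ring_1 mpoly \<Rightarrow> bool" where
  "reducible p \<longleftrightarrow> (\<exists>a b. p = a * b \<and> \<not> a dvd 1 \<and> \<not> b dvd 1)"

text \<open>Every K-linear combination of the components of G and 1 which is reducible
  is a scalar multiple of 1.\<close>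
definition lincomb_prop :: "nat \<Rightarrow> (nat \<Rightarrow> 'a::comm_ring_1 mpoly) \<Rightarrow> bool" where
  "lincomb_prop m G \<longleftrightarrow> (\<forall>c0 c. reducible (Const c0 + (\<Sum>i<m. Const (c i) * G i)) \<longrightarrow>
      (\<exists>a. Const c0 + (\<Sum>i<m. Const (c i) * G i) = Const a))"

definition jac_symmetric :: "nat \<Rightarrow> (nat \<Rightarrow> 'a::comm_ring_1 mpoly) \<Rightarrow> bool" where
  "jac_symmetric m F \<longleftrightarrow> (\<forall>i<m. \<forall>j<m. pdiff j (F i) = pdiff i (F j))"

end

theory Submission
  imports Defs "HOL-Library.Function_Algebras"
begin

text \<open>
  The gradient of a nontrivial combination \<open>f = c\<^sub>0 + \<Sum> c\<^sub>i F\<^sub>i\<close> is unimodular, because the Jacobian matrix is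
  invertible. If \<open>a = c \<cdot> \<lambda> \<noteq> 0\<close>, a factorization of \<open>f - a y\<^sup>3 + b y\<close> gives a root \<open>s\<close> in \<open>K[x]\<close>, hence
  \<open>f = a s\<^sup>3 - b s\<close> and \<open>3 a s\<^sup>2 - b\<close> divides the gradient, so that \<open>s\<close> and \<open>f\<close> would be constant.
  If \<open>c \<cdot> \<lambda> = 0\<close>, the problem is a reducible \<open>f\<close>, and unimodularity forces such an \<open>f\<close> to have the form
  \<open>L + L\<^sup>2 \<rho>\<close> with linear forms \<open>L\<close> and \<open>\<rho> \<noteq> 0\<close>. Pairwise non-proportional vectors \<open>c\<close> of this kind are
  linearly independent: a dependency would make the \<open>\<rho>\<^sub>i\<close> forms in the \<open>L\<^sub>j\<close> involved, and then
  the Jacobian determinant of the components \<open>L\<^sub>i + L\<^sub>i\<^sup>2 \<rho>\<^sub>i\<close> cannot be constant. Hence some \<open>\<lambda>\<close>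
  satisfies \<open>c \<cdot> \<lambda> \<noteq> 0\<close> for all of these \<open>c\<close>.\<close>

subsection \<open>Evaluation homomorphisms\<close>

text \<open>The choice of \<open>\<lambda>\<close> is the obstacle: it has to avoid the hyperplanes
  \<open>c \<cdot> \<lambda> = 0\<close> of all bad vectors \<open>c\<close>, and over a countable
  field infinitely many hyperplanes can cover the whole space. Linear independence leaves at most
  \<open>n\<close> directions to avoid. With \<open>y\<close> for \<open>Var n\<close>, the case
  \<open>c \<cdot> \<lambda> = 0\<close> leaves \<open>f + b y\<close>. This is linear in
  \<open>y\<close> with a constant leading coefficient, hence irreducible unless
  \<open>b = 0\<close>, so only \<open>f\<close> itself remains. The same argument disposes of
  \<open>Var (n + 1)\<close>, which occurs linearly and in one component only of (b) and (c);
  therefore one \<open>\<lambda>\<close> serves all three maps. A dependency compares the cubic part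
  \<open>\<Sum> t s (L s)^2 (\<rho> s)\<close> with \<open>(\<Sum> t s (L s))^2 \<sigma>\<close>.
  The cross terms of the second square have no counterpart, which forces \<open>\<sigma>\<close>,
  and with it every \<open>\<rho> s\<close>, to vanish where all \<open>L s\<close> vanish.
  Factorizations are controlled by degrees alone: a polynomial is read as a univariate one, in a
  chosen variable or in a degree-counting parameter, over a domain, and there the degrees of factors
  add.\<close>

definition mval :: "(nat \<Rightarrow> 'b::comm_ring_1) \<Rightarrow> (nat \<Rightarrow>\<^sub>0 nat) \<Rightarrow> 'b" where
  "mval X m = (\<Prod>i\<in>Poly_Mapping.keys m. X i ^ Poly_Mapping.lookup m i)"

text \<open>Evaluation in an arbitrary commutative ring, with \<open>h\<close> acting on the
  coefficients. Substitution, expansion in one variable and the grading by degree are instances, and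
  a partial derivative is a coefficient of one, so all product formulas have a common
  source.\<close>

definition ins :: "('a::comm_ring_1 \<Rightarrow> 'b::comm_ring_1) \<Rightarrow> (nat \<Rightarrow> 'b) \<Rightarrow> 'a mpoly \<Rightarrow> 'b" where
  "ins h X p = (\<Sum>m\<in>Poly_Mapping.keys p. h (Poly_Mapping.lookup p m) * mval X m)"

lemma mval_superset:
  "finite A \<Longrightarrow> Poly_Mapping.keys m \<subseteq> A \<Longrightarrow> mval X m = (\<Prod>i\<in>A. X i ^ Poly_Mapping.lookup m i)"
  unfolding mval_def by (rule prod.mono_neutral_left) (auto simp: in_keys_iff)

lemma mval_0 [simp]: "mval X 0 = 1"
  by (simp add: mval_def)

lemma mval_add: "mval X (k + l) = mval X k * mval X l"
proof -
  let ?A = "Poly_Mapping.keys k \<union> Poly_Mapping.keys l"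
  have "Poly_Mapping.keys (k + l) \<subseteq> ?A" by (rule keys_add)
  then show ?thesis
    by (simp add: mval_superset[of ?A] lookup_add power_add prod.distrib)
qed

lemma mval_single [simp]: "mval X (Poly_Mapping.single i e) = X i ^ e"
  by (simp add: mval_def)

lemma mpoly_monomials:
  "p = (\<Sum>m\<in>Poly_Mapping.keys p. Poly_Mapping.single m (Poly_Mapping.lookup p m))"
  by (rule poly_mapping_eqI) (auto simp: lookup_sum lookup_single when_def in_keys_iff)

lemma Const_hom: "comm_ring_hom (Const :: 'a::comm_ring_1 \<Rightarrow> 'a mpoly)"
  by unfold_locales (simp_all add: Const_def single_add mult_single)

lemma Const_0 [simp]: "Const 0 = 0" and Const_1 [simp]: "Const 1 = 1"
  by (simp_all add: Const_def)

lemma Const_add: "Const (a + b) = Const a + Const b"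
  and Const_mult: "Const (a * b) = Const a * Const b"
  and Const_uminus: "Const (- a) = - Const a"
  and Const_diff: "Const (a - b) = Const a - Const b"
  by (simp_all add: Const_def single_add mult_single single_uminus single_diff)

lemma Const_power: "Const (a ^ k) = Const a ^ k"
  by (induction k) (simp_all add: Const_mult)

lemma Const_sum: "Const (sum f A) = (\<Sum>i\<in>A. Const (f i))"
  by (induction A rule: infinite_finite_induct) (simp_all add: Const_add)

lemma Const_of_nat [simp]: "Const (of_nat k) = of_nat k"
  by (simp add: Const_def)

lemma Const_numeral [simp]: "Const (numeral k) = numeral k"
  by (simp add: Const_def)

lemma Const_eq_iff [simp]: "Const a = Const b \<longleftrightarrow> a = b"
  unfolding Const_def by (metis lookup_single_eq)

lemma Const_eq_0_iff [simp]: "Const a = 0 \<longleftrightarrow> a = 0"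
  using Const_eq_iff[of a 0] by simp

lemma Const_dvd_1: "a \<noteq> 0 \<Longrightarrow> Const (a :: 'a::field) dvd 1"
  by (rule dvdI[of _ _ "Const (inverse a)"]) (simp flip: Const_mult)

context
  fixes h :: "'a::comm_ring_1 \<Rightarrow> 'b::comm_ring_1"
  assumes h: "comm_ring_hom h"
begin

interpretation h: comm_ring_hom h by (rule h)

lemma ins_superset:
  "finite A \<Longrightarrow> Poly_Mapping.keys p \<subseteq> A \<Longrightarrow> ins h X p = (\<Sum>m\<in>A. h (Poly_Mapping.lookup p m) * mval X m)"
  unfolding ins_def by (rule sum.mono_neutral_left) (auto simp: in_keys_iff)

lemma ins_single: "ins h X (Poly_Mapping.single m c) = h c * mval X m"
  by (subst ins_superset[of "{m}"]) (auto simp: lookup_single when_def split: if_splits)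

lemma ins_add: "ins h X (p + q) = ins h X p + ins h X q"
proof -
  let ?A = "Poly_Mapping.keys p \<union> Poly_Mapping.keys q"
  have "Poly_Mapping.keys (p + q) \<subseteq> ?A" by (rule keys_add)
  then show ?thesis
    by (simp add: ins_superset[of ?A] lookup_add h.hom_add distrib_right sum.distrib)
qed

lemma ins_0: "ins h X 0 = 0"
  by (simp add: ins_def)

lemma ins_sum: "ins h X (sum f A) = (\<Sum>i\<in>A. ins h X (f i))"
  by (induction A rule: infinite_finite_induct) (simp_all add: ins_add ins_0)

lemma ins_mult: "ins h X (p * q) = ins h X p * ins h X q"
proof -
  let ?P = "Poly_Mapping.keys p" and ?Q = "Poly_Mapping.keys q"
  have "p * q = (\<Sum>m\<in>?P. \<Sum>k\<in>?Q. Poly_Mapping.single (m + k) (Poly_Mapping.lookup p m * Poly_Mapping.lookup q k))"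
    by (subst (1) mpoly_monomials[of p], subst (1) mpoly_monomials[of q])
      (simp add: sum_product mult_single)
  then have "ins h X (p * q) = (\<Sum>m\<in>?P. \<Sum>k\<in>?Q. h (Poly_Mapping.lookup p m * Poly_Mapping.lookup q k) * mval X (m + k))"
    by (simp add: ins_sum ins_single)
  also have "\<dots> = ins h X p * ins h X q"
    by (simp add: ins_def sum_product h.hom_mult mval_add algebra_simps)
  finally show ?thesis .
qed

lemma ins_Const: "ins h X (Const c) = h c"
  by (simp add: Const_def ins_single)

lemma ins_Var: "ins h X (Var i) = X i"
  by (simp add: Var_def ins_single)

lemma ins_hom: "comm_ring_hom (ins h X)"
  using ins_Const[of X 1] by unfold_locales (simp_all add: ins_add ins_mult ins_0)

end

lemma ins_cong:
  assumes "\<And>i. i \<in> vars p \<Longrightarrow> X i = Y i"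
  shows "ins h X p = ins h Y p"
  unfolding ins_def mval_def
  by (intro sum.cong refl arg_cong2[of _ _ _ _ "(*)"] prod.cong)
    (metis UN_I assms vars_def)

lemma hom_mval:
  assumes "comm_ring_hom g"
  shows "g (mval X m) = mval (\<lambda>i. g (X i)) m"
proof -
  interpret comm_ring_hom g by fact
  show ?thesis by (simp add: mval_def hom_prod hom_power)
qed

lemma hom_ins:
  assumes "comm_ring_hom g"
  shows "g (ins h X p) = ins (\<lambda>c. g (h c)) (\<lambda>i. g (X i)) p"
proof -
  interpret comm_ring_hom g by fact
  show ?thesis by (simp add: ins_def hom_sum hom_mult hom_mval[OF assms])
qed

section \<open>Substitution as an evaluation homomorphism\<close>

lemma subst_ins: "subst p q = ins Const q p"
  by (simp add: subst_def ins_def mval_def)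

lemma mval_Var: "mval Var m = Poly_Mapping.single m 1"
proof -
  have pw: "Var i ^ k = (Poly_Mapping.single (Poly_Mapping.single i k) 1 :: 'a mpoly)" for i k
    by (induction k) (simp_all add: Var_def mult_single flip: single_add)
  have "(\<Prod>i\<in>A. Poly_Mapping.single (g i) 1) = (Poly_Mapping.single (\<Sum>i\<in>A. g i) 1 :: 'a mpoly)"
    for A and g :: "nat \<Rightarrow> nat \<Rightarrow>\<^sub>0 nat"
    by (induction A rule: infinite_finite_induct) (simp_all add: mult_single)
  then show ?thesis
    by (simp add: mval_def pw flip: mpoly_monomials)
qed

lemma ins_Var_id: "ins Const Var p = p"
  by (subst (2) mpoly_monomials[of p]) (simp add: ins_def mval_Var Const_def mult_single)

lemma ins_subst:
  assumes "comm_ring_hom h"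
  shows "ins h X (subst p q) = ins h (\<lambda>i. ins h X (q i)) p"
  by (simp add: subst_ins hom_ins[OF ins_hom[OF assms]] ins_Const[OF assms])

lemma subst_subst: "subst (subst p q) r = subst p (\<lambda>i. subst (q i) r)"
  using ins_subst[OF Const_hom] by (simp add: subst_ins)

lemma subst_hom: "comm_ring_hom (\<lambda>p. subst p q)"
  unfolding subst_ins by (rule ins_hom[OF Const_hom])

lemma subst_cong: "(\<And>i. i \<in> vars p \<Longrightarrow> q i = r i) \<Longrightarrow> subst p q = subst p r"
  unfolding subst_ins by (rule ins_cong)

lemma subst_Var_id: "subst p Var = p"
  by (simp add: subst_ins ins_Var_id)

lemma subst_simps [simp]:
  "subst (Const c) q = Const c" "subst (Var i) q = q i" "subst 0 q = 0" "subst 1 q = 1"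
  "subst (p + p') q = subst p q + subst p' q" "subst (p * p') q = subst p q * subst p' q"
  "subst (p - p') q = subst p q - subst p' q" "subst (- p) q = - subst p q"
  "subst (p ^ k) q = subst p q ^ k" "subst (numeral w) q = numeral w"
proof -
  interpret comm_ring_hom "\<lambda>p. subst p q" by (rule subst_hom)
  show "subst (Const c) q = Const c" "subst (Var i) q = q i" "subst 0 q = 0" "subst 1 q = 1"
    "subst (p + p') q = subst p q + subst p' q" "subst (p * p') q = subst p q * subst p' q"
    "subst (p - p') q = subst p q - subst p' q" "subst (- p) q = - subst p q"
    "subst (p ^ k) q = subst p q ^ k"
    by (simp_all add: hom_add hom_mult hom_minus hom_uminus hom_power
        subst_ins[of "Const c"] subst_ins[of "Var i"] ins_Const[OF Const_hom] ins_Var[OF Const_hom])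
  have "subst (Const (numeral w)) q = Const (numeral w)"
    by (simp only: subst_ins ins_Const[OF Const_hom])
  then show "subst (numeral w) q = numeral w" by simp
qed

lemma subst_sum [simp]: "subst (sum f A) q = (\<Sum>i\<in>A. subst (f i) q)"
  by (simp add: subst_ins ins_sum[OF Const_hom])

lemma const_poly_hom: "comm_ring_hom (\<lambda>c. [:h c:])" if "comm_ring_hom h"
proof -
  interpret comm_ring_hom h by fact
  show ?thesis by unfold_locales (simp_all add: hom_add hom_mult one_pCons)
qed

lemma Const_poly_hom: "comm_ring_hom (\<lambda>c :: 'a::comm_ring_1. [:Const c:])"
  by (rule const_poly_hom[OF Const_hom])

lemma coeff_0_hom: "comm_ring_hom (\<lambda>p :: 'a::comm_ring_1 poly. coeff p 0)"
  by unfold_locales (simp_all add: coeff_mult)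

lemma poly_hom: "comm_ring_hom (\<lambda>p :: 'a::comm_ring_1 poly. poly p x)"
  by unfold_locales simp_all

lemma const_poly_ident_hom: "comm_ring_hom (\<lambda>c :: 'a::comm_ring_1. [:c:])"
  by unfold_locales (simp_all add: one_pCons)

lemma coeff_mult_1: "coeff (p * q) 1 = coeff p 0 * coeff q 1 + coeff p 1 * coeff q 0"
  by (simp add: coeff_mult)

subsection \<open>Partial derivatives\<close>

text \<open>The expansion of \<open>p\<close> at \<open>x + t e_i\<close> in powers of
  \<open>t\<close>: its linear coefficient is the partial derivative, and the product rule becomes
  the formula for the linear coefficient of a product.\<close>

abbreviation dual :: "nat \<Rightarrow> 'a::comm_ring_1 mpoly \<Rightarrow> 'a mpoly poly" where
  "dual i \<equiv> ins (\<lambda>c. [:Const c:]) (\<lambda>j. [:Var j, if j = i then 1 else 0:])"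

lemma dual_hom: "comm_ring_hom (dual i)"
  by (rule ins_hom[OF Const_poly_hom])

lemma coeff_0_dual: "coeff (dual i p) 0 = p"
  by (simp add: hom_ins[OF coeff_0_hom] ins_Var_id)

lemma coeff_1_linear_power:
  "coeff ([:a, 1:] ^ e) 1 = of_nat e * (a :: 'a::comm_ring_1) ^ (e - 1)"
proof (induction e)
  case (Suc e)
  have "coeff ([:a, 1:] ^ e) 0 = a ^ e" for e
    by (induction e) (simp_all add: coeff_mult)
  with Suc show ?case
    by (cases e) (simp_all add: coeff_mult_1[unfolded One_nat_def] algebra_simps)
qed simp

lemma coeff_dual_monomial:
  fixes i :: nat and e :: "nat \<Rightarrow> nat"
  assumes "finite A"
  shows "coeff (\<Prod>j\<in>A. [:Var j, if j = i then 1 else 0:] ^ e j) 1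
    = (if i \<in> A then of_nat (e i) * (\<Prod>j\<in>A. Var j ^ (if j = i then e j - 1 else e j))
       else (0 :: 'a::comm_ring_1 mpoly))"
  using assms
proof induction
  case (insert k A)
  have c0: "coeff ([:b, c:] ^ l) 0 = b ^ l" for b c :: "'a mpoly" and l
    by (induction l) (simp_all add: coeff_mult)
  have c0p: "coeff (\<Prod>j\<in>A. [:Var j, if j = i then 1 else 0:] ^ e j) 0 = (\<Prod>j\<in>A. Var j ^ e j :: 'a mpoly)"
    using insert.hyps(1) by induction (simp_all add: coeff_mult c0)
  have cst: "coeff ([:b, 0:] ^ l) 1 = 0" for b :: "'a mpoly" and l
    by (induction l) (simp_all add: coeff_mult)
  show ?case
  proof (cases "k = i")
    case True
    then have "(\<Prod>j\<in>A. Var j ^ (if j = i then e j - 1 else e j)) = (\<Prod>j\<in>A. Var j ^ e j :: 'a mpoly)"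
      using insert.hyps by (intro prod.cong) auto
    with True insert show ?thesis
      by (simp add: coeff_mult_1 c0 c0p coeff_1_linear_power[unfolded One_nat_def] del: One_nat_def)
        (simp add: coeff_1_linear_power[unfolded One_nat_def] algebra_simps)
  next
    case False
    with insert show ?thesis
      using cst c0[of _ 0] by (auto simp add: coeff_mult_1 c0 c0p algebra_simps simp del: One_nat_def)
  qed
qed simp

text \<open>It suffices to compare monomials, and there only the power of \<open>Var i + t\<close>
  contributes to the coefficient of \<open>t\<close>.\<close>

lemma pdiff_dual: "pdiff i p = coeff (dual i p) 1"
proof -
  have "coeff (mval (\<lambda>j. [:Var j, if j = i then 1 else 0:]) m) 1 =
      of_nat (Poly_Mapping.lookup m i) * (\<Prod>j\<in>Poly_Mapping.keys m. Var j ^ (if j = i then Poly_Mapping.lookup m j - 1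
          else Poly_Mapping.lookup m j) :: 'a mpoly)" for m
    unfolding mval_def coeff_dual_monomial[OF finite_keys] by (simp add: in_keys_iff)
  then show ?thesis
    by (simp add: pdiff_def ins_def coeff_sum Const_mult algebra_simps del: One_nat_def)
qed

lemma pdiff_simps [simp]:
  "pdiff i (p + q) = pdiff i p + pdiff i q"
  "pdiff i (p - q) = pdiff i p - pdiff i q"
  "pdiff i (- p) = - pdiff i p"
  "pdiff i (p * q) = p * pdiff i q + pdiff i p * q"
  "pdiff i 0 = 0" "pdiff i 1 = 0" "pdiff i (numeral w) = 0" "pdiff i (Const c) = 0"
  "pdiff i (Var j) = (if j = i then 1 else 0)"
proof -
  interpret comm_ring_hom "dual i" by (rule dual_hom)
  show "pdiff i (p + q) = pdiff i p + pdiff i q"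
    "pdiff i (p - q) = pdiff i p - pdiff i q"
    "pdiff i (- p) = - pdiff i p"
    "pdiff i (p * q) = p * pdiff i q + pdiff i p * q"
    by (simp_all add: pdiff_dual hom_add hom_minus hom_uminus hom_mult coeff_mult_1 coeff_0_dual
        del: One_nat_def)
  show C: "pdiff i (Const c) = 0" for c
    by (simp add: pdiff_dual ins_Const[OF Const_poly_hom])
  show "pdiff i 0 = 0" "pdiff i 1 = 0" "pdiff i (numeral w) = 0"
    using C[of 0] C[of 1] C[of "numeral w"] by simp_all
  show "pdiff i (Var j) = (if j = i then 1 else 0)"
    by (simp add: pdiff_dual ins_Var[OF Const_poly_hom])
qed

lemma pdiff_sum [simp]: "pdiff i (sum f A) = (\<Sum>j\<in>A. pdiff i (f j))"
  by (induction A rule: infinite_finite_induct) simp_all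

lemma pdiff_power: "pdiff i (p ^ k) = of_nat k * p ^ (k - 1) * pdiff i p"
proof (induction k)
  case (Suc k)
  then show ?case by (cases k) (simp_all add: algebra_simps)
qed simp

lemma pdiff_notin_vars:
  assumes "i \<notin> vars p"
  shows "pdiff i p = 0"
proof -
  have "dual i p = ins (\<lambda>c. [:Const c:]) (\<lambda>j. [:Var j:]) p"
    by (rule ins_cong) (use assms in auto)
  also have "\<dots> = [:p:]"
    using hom_ins[OF const_poly_ident_hom, of Const Var p] by (simp add: ins_Var_id)
  finally show ?thesis by (simp add: pdiff_dual)
qed

subsection \<open>Variables and degrees\<close>

lemma vars_Const [simp]: "vars (Const c) = {}"
  by (auto simp: vars_def Const_def split: if_splits)

lemma vars_Var [simp]: "vars (Var i :: 'a::comm_ring_1 mpoly) = {i}"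
  by (auto simp: vars_def Var_def)

lemma vars_0 [simp]: "vars 0 = {}" and vars_1 [simp]: "vars 1 = {}"
  and vars_numeral [simp]: "vars (numeral w) = {}"
  using vars_Const[of 0] vars_Const[of 1] vars_Const[of "numeral w"] by simp_all

lemma vars_add: "vars (p + q) \<subseteq> vars p \<union> vars q"
  using keys_add[of p q] by (auto simp: vars_def)

lemma vars_uminus [simp]: "vars (- p) = vars p"
  by (simp add: vars_def keys_def)

lemma vars_diff: "vars (p - q) \<subseteq> vars p \<union> vars q"
  using vars_add[of p "- q"] by simp

lemma vars_mult: "vars (p * q) \<subseteq> vars p \<union> vars q"
proof
  fix i assume "i \<in> vars (p * q)"
  then obtain m where m: "m \<in> Poly_Mapping.keys (p * q)" "i \<in> Poly_Mapping.keys m"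
    by (auto simp: vars_def)
  then obtain a b where "m = a + b" "a \<in> Poly_Mapping.keys p" "b \<in> Poly_Mapping.keys q"
    using keys_mult[of p q] by blast
  then show "i \<in> vars p \<union> vars q"
    using m(2) keys_add[of a b] by (auto simp: vars_def)
qed

lemma vars_power: "vars (p ^ k) \<subseteq> vars p"
proof (induction k)
  case (Suc k)
  then show ?case using vars_mult[of p "p ^ k"] by auto
qed simp

lemma vars_sum: "vars (sum f A) \<subseteq> (\<Union>i\<in>A. vars (f i))"
proof (induction A rule: infinite_finite_induct)
  case (insert x A)
  then show ?case using vars_add[of "f x" "sum f A"] by auto
qed simp_all

lemma vars_prod: "vars (prod f A) \<subseteq> (\<Union>i\<in>A. vars (f i))"
proof (induction A rule: infinite_finite_induct)
  case (insert x A)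
  then show ?case using vars_mult[of "f x" "prod f A"] by auto
qed simp_all

lemma vars_subst: "vars (subst p q) \<subseteq> (\<Union>i\<in>vars p. vars (q i))"
proof -
  have "vars (Const (Poly_Mapping.lookup p m) * (\<Prod>i\<in>Poly_Mapping.keys m. q i ^ Poly_Mapping.lookup m i))
      \<subseteq> (\<Union>i\<in>vars p. vars (q i))" if "m \<in> Poly_Mapping.keys p" for m
  proof -
    have "vars (\<Prod>i\<in>Poly_Mapping.keys m. q i ^ Poly_Mapping.lookup m i)
        \<subseteq> (\<Union>i\<in>Poly_Mapping.keys m. vars (q i))"
      using vars_prod vars_power by fastforce
    also have "\<dots> \<subseteq> (\<Union>i\<in>vars p. vars (q i))"
      using that by (auto simp: vars_def)
    finally show ?thesis
      using vars_mult by fastforce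
  qed
  then show ?thesis
    unfolding subst_def using vars_sum by fastforce
qed

text \<open>The coefficient of \<open>t^k\<close> is the homogeneous component of degree \<open>k\<close>.\<close>
abbreviation graded :: "'a::comm_ring_1 mpoly \<Rightarrow> 'a mpoly poly" where
  "graded \<equiv> ins (\<lambda>c. [:Const c:]) (\<lambda>i. [:0, Var i:])"

lemma graded_hom: "comm_ring_hom graded"
  by (rule ins_hom[OF Const_poly_hom])

lemma poly_graded_1: "poly (graded p) 1 = p"
  by (simp add: hom_ins[OF poly_hom] ins_Var_id)

lemma mval_scaled: "mval (\<lambda>i. [:0, X i:]) m = monom (mval X m) (mdeg m)"
proof -
  have "(\<Prod>i\<in>A. [:0, X i:] ^ e i) = monom (\<Prod>i\<in>A. X i ^ e i) (\<Sum>i\<in>A. e i)"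
    for A and e :: "nat \<Rightarrow> nat"
  proof (induction A rule: infinite_finite_induct)
    case (insert x A)
    have "[:0, X x:] = monom (X x) 1"
      by (simp add: monom_Suc monom_0)
    with insert show ?case by (simp add: monom_power mult_monom)
  qed simp_all
  then show ?thesis by (simp add: mval_def mdeg_def)
qed

lemma coeff_graded: "coeff (graded p) k =
    (\<Sum>m | m \<in> Poly_Mapping.keys p \<and> mdeg m = k. Poly_Mapping.single m (Poly_Mapping.lookup p m))"
proof -
  have "coeff ([:Const c:] * mval (\<lambda>i. [:0, Var i:]) m) k =
      (if mdeg m = k then Poly_Mapping.single m c else 0)" for m and c :: 'a
    by (simp add: mval_scaled mval_Var Const_def mult_single)
  then have "coeff (graded p) k = (\<Sum>m\<in>Poly_Mapping.keys p.
      if mdeg m = k then Poly_Mapping.single m (Poly_Mapping.lookup p m) else 0)"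
    unfolding ins_def coeff_sum by simp
  also have "\<dots> = (\<Sum>m\<in>{m \<in> Poly_Mapping.keys p. mdeg m = k}. Poly_Mapping.single m (Poly_Mapping.lookup p m))"
    by (rule sum.inter_filter[symmetric]) simp
  finally show ?thesis by simp
qed

text \<open>Homogeneity: multiplying the arguments of the component of degree \<open>k\<close> by
  \<open>t\<close> multiplies its value by \<open>t^k\<close>. A general \<open>X\<close> is allowed
  because the arguments will also be points of a hyperplane.\<close>

lemma ins_scaled_coeff_graded:
  "ins (\<lambda>c. [:Const c:]) (\<lambda>i. [:0, X i:]) (coeff (graded p) k) = monom (subst (coeff (graded p) k) X) k"
proof -
  have [simp]: "smult (Const c) (monom (mval X m) j) = monom (Const c * mval X m) j" for c m j
    by (simp add: smult_monom)
  have ms: "monom (sum f A) k = (\<Sum>m\<in>A. monom (f m) k)" for f :: "(nat \<Rightarrow>\<^sub>0 nat) \<Rightarrow> 'a mpoly" and A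
    by (simp add: poly_eq_iff coeff_sum)
  show ?thesis
    unfolding coeff_graded subst_ins ins_sum[OF Const_poly_hom] ins_sum[OF Const_hom]
      ins_single[OF Const_poly_hom] ins_single[OF Const_hom] mval_scaled ms
    by (intro sum.cong refl) auto
qed

lemma graded_coeff_graded: "graded (coeff (graded p) k) = monom (coeff (graded p) k) k"
  using ins_scaled_coeff_graded[of Var p k] by (simp add: subst_Var_id)

lemma vars_coeff_graded: "vars (coeff (graded p) k) \<subseteq> vars p"
proof -
  have "vars (Poly_Mapping.single m c) \<subseteq> Poly_Mapping.keys m" for m and c :: 'a
    by (auto simp: vars_def split: if_splits)
  moreover have "(\<Union>m\<in>{m \<in> Poly_Mapping.keys p. mdeg m = k}. Poly_Mapping.keys m) \<subseteq> vars p"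
    by (auto simp: vars_def)
  ultimately show ?thesis
    unfolding coeff_graded by (intro order_trans[OF vars_sum]) blast
qed

lemma coeff_0_graded: "coeff (graded p) 0 = Const (Poly_Mapping.lookup p 0)"
proof -
  have "coeff (graded p) 0 = ins Const (\<lambda>_. 0) p"
    by (simp add: hom_ins[OF coeff_0_hom])
  also have "\<dots> = (\<Sum>m\<in>Poly_Mapping.keys p. if m = 0 then Const (Poly_Mapping.lookup p m) else 0)"
    unfolding ins_def
  proof (intro sum.cong refl)
    fix m :: "nat \<Rightarrow>\<^sub>0 nat"
    show "Const (Poly_Mapping.lookup p m) * mval (\<lambda>_. 0) m = (if m = 0 then Const (Poly_Mapping.lookup p m) else 0)"
    proof (cases "m = 0")
      case False
      then obtain i where "i \<in> Poly_Mapping.keys m" by (metis keys_eq_empty ex_in_conv)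
      then have "mval (\<lambda>_. 0 :: 'a mpoly) m = 0"
        unfolding mval_def by (intro prod_zero) (auto simp: in_keys_iff zero_power intro!: bexI[of _ i])
      with False show ?thesis by simp
    qed simp
  qed
  finally show ?thesis by (auto simp: in_keys_iff)
qed

lemma degree_graded_eq_0: "degree (graded p) = 0 \<Longrightarrow> p = Const (Poly_Mapping.lookup p 0)"
proof -
  assume "degree (graded p) = 0"
  then obtain a where a: "graded p = [:a:]" by (rule degree_eq_zeroE)
  then have "p = a" using poly_graded_1[of p] by simp
  moreover have "a = Const (Poly_Mapping.lookup p 0)" using coeff_0_graded[of p] a by simp
  ultimately show ?thesis by simp
qed

text \<open>The grading is multiplicative with values in univariate polynomials over a domain, where
  units have degree \<open>0\<close>; and a polynomial whose grading has degree \<open>0\<close> is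
  constant.\<close>

lemma unit_mpolyD:
  fixes p :: "'a::field_char_0 mpoly"
  assumes "p dvd 1"
  obtains c where "p = Const c" "c \<noteq> 0"
proof -
  obtain q where "1 = p * q" using assms by (elim dvdE)
  then have "graded 1 = graded p * graded q"
    by (metis ins_mult[OF Const_poly_hom])
  moreover have "graded (1 :: 'a mpoly) = 1"
    using ins_Const[OF Const_poly_hom, of "\<lambda>i. [:0, Var i:]" 1] by (simp flip: one_pCons)
  ultimately have "1 = graded p * graded q" by metis
  then have "graded p dvd 1" by (rule dvdI)
  then have "degree (graded p) = 0" by (auto simp: is_unit_poly_iff)
  then have "p = Const (Poly_Mapping.lookup p 0)" by (rule degree_graded_eq_0)
  moreover have "p \<noteq> 0" using assms by auto
  ultimately show ?thesis using that by (metis Const_0)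
qed

section \<open>Total degree of monomials and linear parts\<close>

lemma mdeg_superset: "finite A \<Longrightarrow> Poly_Mapping.keys m \<subseteq> A \<Longrightarrow> mdeg m = (\<Sum>i\<in>A. Poly_Mapping.lookup m i)"
  unfolding mdeg_def by (rule sum.mono_neutral_left) (auto simp: in_keys_iff)

lemma mdeg_add: "mdeg (k + l) = mdeg k + mdeg l"
proof -
  let ?A = "Poly_Mapping.keys k \<union> Poly_Mapping.keys l"
  have "Poly_Mapping.keys (k + l) \<subseteq> ?A" by (rule keys_add)
  then show ?thesis
    by (simp add: mdeg_superset[of ?A] lookup_add sum.distrib)
qed

lemma mdeg_single [simp]: "mdeg (Poly_Mapping.single i e) = e"
  by (simp add: mdeg_def)

lemma mdeg_1E:
  assumes "mdeg m = 1"
  obtains i where "m = Poly_Mapping.single i 1"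
proof -
  have "m \<noteq> 0" using assms by (auto simp: mdeg_def)
  then obtain i where i: "i \<in> Poly_Mapping.keys m" by (metis keys_eq_empty ex_in_conv)
  have s: "mdeg m = Poly_Mapping.lookup m i + (\<Sum>j\<in>Poly_Mapping.keys m - {i}. Poly_Mapping.lookup m j)"
    using i by (simp add: mdeg_def sum.remove)
  moreover have "Poly_Mapping.lookup m i > 0" using i by (simp add: in_keys_iff)
  ultimately have *: "Poly_Mapping.lookup m i = 1" and "(\<Sum>j\<in>Poly_Mapping.keys m - {i}. Poly_Mapping.lookup m j) = 0"
    using assms by linarith+
  then have "j \<notin> Poly_Mapping.keys m" if "j \<noteq> i" for j
    using that by (auto simp: in_keys_iff)
  then have "m = Poly_Mapping.single i 1"
    using * by (intro poly_mapping_eqI) (auto simp: lookup_single when_def in_keys_iff)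
  then show ?thesis by (rule that)
qed

definition linform :: "nat \<Rightarrow> (nat \<Rightarrow> 'a::comm_ring_1) \<Rightarrow> 'a mpoly" where
  "linform n l = (\<Sum>i<n. Const (l i) * Var i)"

lemma coeff_1_graded:
  assumes "vars p \<subseteq> {..<n}"
  obtains l where "coeff (graded p) 1 = linform n l"
proof
  let ?K = "{m \<in> Poly_Mapping.keys p. mdeg m = 1}" and ?s = "\<lambda>i. Poly_Mapping.single i 1 :: nat \<Rightarrow>\<^sub>0 nat"
  have inj: "inj_on ?s {..<n}"
    by (rule inj_onI, drule arg_cong[of _ _ Poly_Mapping.keys]) simp
  have "?K \<subseteq> ?s ` {..<n}"
  proof
    fix m assume m: "m \<in> ?K"
    then obtain i where i: "m = ?s i" using mdeg_1E by blast
    then have "i \<in> vars p" using m by (auto simp: vars_def intro!: bexI[of _ m])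
    then show "m \<in> ?s ` {..<n}" using assms i by auto
  qed
  then have "coeff (graded p) 1 = (\<Sum>m\<in>?s ` {..<n}. Poly_Mapping.single m (Poly_Mapping.lookup p m))"
    unfolding coeff_graded by (intro sum.mono_neutral_left) (auto simp: in_keys_iff)
  also have "\<dots> = (\<Sum>i<n. Const (Poly_Mapping.lookup p (?s i)) * Var i)"
    by (simp add: sum.reindex[OF inj[unfolded One_nat_def]] Const_def Var_def mult_single)
  finally show "coeff (graded p) 1 = linform n (\<lambda>i. Poly_Mapping.lookup p (?s i))"
    by (simp add: linform_def)
qed

text \<open>Regards \<open>p\<close> as a univariate polynomial in the variable \<open>Var z\<close>.\<close>
abbreviation main_var :: "nat \<Rightarrow> 'a::comm_ring_1 mpoly \<Rightarrow> 'a mpoly poly" where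
  "main_var z \<equiv> ins (\<lambda>c. [:Const c:]) (\<lambda>i. if i = z then [:0, 1:] else [:Var i:])"

lemma main_var_hom: "comm_ring_hom (main_var z)"
  by (rule ins_hom[OF Const_poly_hom])

lemma poly_main_var: "poly (main_var z p) (Var z) = p"
proof -
  have "(\<lambda>i. poly (if i = z then [:0, 1:] else [:Var i:]) (Var z)) = (Var :: nat \<Rightarrow> 'a mpoly)"
    by auto
  then show ?thesis by (simp add: hom_ins[OF poly_hom] ins_Var_id)
qed

lemma main_var_notin_vars: "z \<notin> vars p \<Longrightarrow> main_var z p = [:p:]"
proof -
  assume "z \<notin> vars p"
  then have "main_var z p = ins (\<lambda>c. [:Const c:]) (\<lambda>j. [:Var j:]) p"
    by (intro ins_cong) auto
  also have "\<dots> = [:p:]"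
    using hom_ins[OF const_poly_ident_hom, of Const Var p] by (simp add: ins_Var_id)
  finally show ?thesis .
qed

lemma notin_vars_coeff_main_var: "z \<notin> vars (coeff (main_var z p) k)"
proof -
  have "z \<notin> vars (coeff (mval (\<lambda>i. if i = z then [:0, 1:] else [:Var i:]) m) k :: 'a mpoly)" for m k
  proof -
    have *: "\<forall>k. z \<notin> vars (coeff (q * q') k)"
      if "\<forall>k. z \<notin> vars (coeff q k)" "\<forall>k. z \<notin> vars (coeff q' k)" for q q' :: "'a mpoly poly"
      using that vars_mult vars_sum unfolding coeff_mult by fastforce
    have 1: "\<forall>k. z \<notin> vars (coeff (q ^ e) k)"
      if "\<forall>k. z \<notin> vars (coeff q k)" for q :: "'a mpoly poly" and e
      by (induction e) (use * that in \<open>auto simp: coeff_1\<close>)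
    have 2: "\<forall>k. z \<notin> vars (coeff (prod f A) k)"
      if "\<And>i. \<forall>k. z \<notin> vars (coeff (f i) k)" for f :: "nat \<Rightarrow> 'a mpoly poly" and A
      by (induction A rule: infinite_finite_induct) (use * that in \<open>auto simp: coeff_1\<close>)
    have 3: "\<forall>k. z \<notin> vars (coeff (if i = z then [:0, 1:] else [:Var i:]) k :: 'a mpoly)" for i
      by (auto simp: coeff_pCons split: nat.splits)
    show ?thesis
      unfolding mval_def by (rule 2[rule_format]) (use 1[OF 3] in auto)
  qed
  then have "z \<notin> vars (coeff ([:Const c:] * mval (\<lambda>i. if i = z then [:0, 1:] else [:Var i:]) m) k)" for m k and c :: 'a
    using vars_mult[of "Const c" "coeff (mval (\<lambda>i. if i = z then [:0, 1:] else [:Var i:]) m) k"] by auto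
  then show ?thesis
    unfolding ins_def coeff_sum using vars_sum by fastforce
qed

subsection \<open>Unimodular gradients\<close>

text \<open>The partial derivatives generate the unit ideal. Explicit cofactors make this property
  pass to every homomorphic image.\<close>

definition unimodular_grad :: "nat \<Rightarrow> 'a::comm_ring_1 mpoly \<Rightarrow> bool" where
  "unimodular_grad n f \<longleftrightarrow> (\<exists>A. (\<Sum>j<n. pdiff j f * A j) = 1)"

text \<open>Images of the partial derivatives still generate the unit ideal, so a common divisor of
  them is a unit. The homomorphism \<open>g\<close> makes it possible to test the gradient on a
  hyperplane only.\<close>

lemma unimodular_grad_dvd:
  assumes "unimodular_grad n f" "comm_ring_hom g" "\<And>j. j < n \<Longrightarrow> u dvd g (pdiff j f)"
  shows "u dvd (1 :: 'b::comm_ring_1)"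
proof -
  interpret comm_ring_hom g by fact
  obtain A where "(\<Sum>j<n. pdiff j f * A j) = 1"
    using assms(1) by (auto simp: unimodular_grad_def)
  then have "(\<Sum>j<n. g (pdiff j f) * g (A j)) = 1"
    by (metis (no_types, lifting) hom_one hom_sum hom_mult sum.cong)
  moreover have "u dvd (\<Sum>j<n. g (pdiff j f) * g (A j))"
    using assms(3) by (intro dvd_sum) auto
  ultimately show ?thesis by simp
qed

lemma id_hom: "comm_ring_hom (\<lambda>x :: 'a::comm_ring_1. x)"
  by unfold_locales simp_all

text \<open>The adjugate matrix, divided by the determinant, which is a nonzero constant.\<close>

lemma keller_right_inverse:
  fixes F :: "nat \<Rightarrow> 'a::field mpoly"
  assumes "keller n F"
  obtains N where "\<And>i k. i < n \<Longrightarrow> k < n \<Longrightarrow>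
    (\<Sum>j<n. pdiff j (F i) * N j k) = (if i = k then 1 else 0)"
proof -
  from assms obtain c where c: "c \<noteq> 0" "det (jac n F) = Const c"
    by (auto simp: keller_def)
  let ?B = "adj_mat (jac n F)"
  have J: "jac n F \<in> carrier_mat n n" by (simp add: jac_def)
  note adj = adj_mat[OF J]
  show ?thesis
  proof
    fix i k assume ik: "i < n" "k < n"
    have "(\<Sum>j<n. pdiff j (F i) * ?B $$ (j, k)) = (jac n F * ?B) $$ (i, k)"
      using ik adj(1) J by (simp add: times_mat_def scalar_prod_def jac_def lessThan_atLeast0)
    also have "\<dots> = (if i = k then Const c else 0)"
      using ik by (simp add: adj(2) c)
    finally have e: "(\<Sum>j<n. pdiff j (F i) * ?B $$ (j, k)) = (if i = k then Const c else 0)" .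
    have "(\<Sum>j<n. pdiff j (F i) * (Const (inverse c) * ?B $$ (j, k)))
        = Const (inverse c) * (\<Sum>j<n. pdiff j (F i) * ?B $$ (j, k))"
      by (simp only: sum_distrib_left mult.left_commute)
    also have "\<dots> = Const (inverse c) * (if i = k then Const c else 0)"
      by (simp only: e)
    finally have "(\<Sum>j<n. pdiff j (F i) * (Const (inverse c) * ?B $$ (j, k)))
        = Const (inverse c) * (if i = k then Const c else 0)" .
    then show "(\<Sum>j<n. pdiff j (F i) * (Const (inverse c) * ?B $$ (j, k))) = (if i = k then 1 else 0)"
      using c by (auto simp flip: Const_mult)
  qed
qed

lemma lincomb_right_inverse:
  fixes F :: "nat \<Rightarrow> 'a::field mpoly"
  assumes N: "\<And>i k. i < n \<Longrightarrow> k < n \<Longrightarrow> (\<Sum>j<n. pdiff j (F i) * N j k) = (if i = k then 1 else 0)"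
  assumes k: "k < n"
  shows "(\<Sum>j<n. pdiff j (Const c0 + (\<Sum>i<n. Const (c i) * F i)) * N j k) = Const (c k)"
proof -
  have "(\<Sum>j<n. pdiff j (Const c0 + (\<Sum>i<n. Const (c i) * F i)) * N j k)
      = (\<Sum>j<n. \<Sum>i<n. Const (c i) * (pdiff j (F i) * N j k))"
    by (simp add: sum_distrib_right mult.assoc)
  also have "\<dots> = (\<Sum>i<n. Const (c i) * (\<Sum>j<n. pdiff j (F i) * N j k))"
    by (subst sum.swap) (simp add: sum_distrib_left)
  also have "\<dots> = (\<Sum>i<n. if i = k then Const (c i) else 0)"
    using k N by (intro sum.cong) auto
  finally show ?thesis using k by simp
qed

text \<open>Column \<open>k\<close> of the right inverse of the Jacobian matrix, divided by
  \<open>c k\<close>, supplies the cofactors.\<close>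

lemma keller_unimodular_grad:
  fixes F :: "nat \<Rightarrow> 'a::field mpoly"
  assumes "keller n F" "k < n" "c k \<noteq> 0"
  shows "unimodular_grad n (Const c0 + (\<Sum>i<n. Const (c i) * F i))"
proof -
  obtain N where N: "\<And>i k. i < n \<Longrightarrow> k < n \<Longrightarrow>
      (\<Sum>j<n. pdiff j (F i) * N j k) = (if i = k then 1 else 0)"
    using keller_right_inverse[OF assms(1)] by blast
  have "(\<Sum>j<n. pdiff j (Const c0 + (\<Sum>i<n. Const (c i) * F i)) * (N j k * Const (inverse (c k))))
      = (\<Sum>j<n. pdiff j (Const c0 + (\<Sum>i<n. Const (c i) * F i)) * N j k) * Const (inverse (c k))"
    by (simp only: sum_distrib_right mult.assoc)
  also have "\<dots> = Const (c k) * Const (inverse (c k))"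
    by (simp only: lincomb_right_inverse[OF N assms(2), of c0 c])
  finally have "(\<Sum>j<n. pdiff j (Const c0 + (\<Sum>i<n. Const (c i) * F i)) * (N j k * Const (inverse (c k)))) = 1"
    using assms(3) by (simp del: pdiff_simps pdiff_sum flip: Const_mult)
  then show ?thesis
    unfolding unimodular_grad_def by (intro exI[of _ "\<lambda>j. N j k * Const (inverse (c k))"])
qed

subsection \<open>Irreducibility\<close>

text \<open>A factor free of \<open>z\<close> divides every coefficient of the product in powers of
  \<open>z\<close>, in particular the leading one, which is a unit.\<close>

lemma main_var_degree_0_unit:
  fixes a b :: "'a::field_char_0 mpoly"
  assumes "main_var z (a * b) = P" "degree P = d" "coeff P d dvd 1" "degree (main_var z b) = 0"
  shows "b dvd 1"
proof -
  obtain q where q: "main_var z b = [:q:]" using assms(4) by (rule degree_eq_zeroE)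
  have "P = main_var z a * [:q:]"
    using assms(1) unfolding ins_mult[OF Const_poly_hom] q by (rule sym)
  then have "coeff P d = coeff (main_var z a) d * q" by simp
  with assms(3) have "coeff (main_var z a) d * q dvd 1" by simp
  moreover have "b = q" using poly_main_var[of z b] by (simp add: q)
  ultimately show ?thesis by (meson dvd_mult_right)
qed

text \<open>The degrees of two factors in \<open>z\<close> add to \<open>1\<close>, so one of them
  is free of \<open>z\<close> and divides the leading coefficient, a nonzero constant.\<close>

lemma not_reducible_linear_in_var:
  fixes r :: "'a::field_char_0 mpoly"
  assumes "e \<noteq> 0" "z \<notin> vars r"
  shows "\<not> reducible (Const e * Var z + r)"
proof
  assume "reducible (Const e * Var z + r)"
  then obtain a b where ab: "Const e * Var z + r = a * b" "\<not> a dvd 1" "\<not> b dvd 1"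
    by (auto simp: reducible_def)
  have m: "main_var z (Const e * Var z + r) = [:r, Const e:]"
    by (simp add: ins_add[OF Const_poly_hom] ins_mult[OF Const_poly_hom] ins_Const[OF Const_poly_hom]
        ins_Var[OF Const_poly_hom] main_var_notin_vars[OF assms(2)])
  then have "main_var z a * main_var z b = [:r, Const e:]"
    using ab(1) ins_mult[OF Const_poly_hom, of _ a b] by simp
  moreover from this have "main_var z a \<noteq> 0" "main_var z b \<noteq> 0" using assms by auto
  ultimately have "degree (main_var z a) + degree (main_var z b) = 1"
    using assms by (subst degree_mult_eq[symmetric]) auto
  then consider "degree (main_var z a) = 0" | "degree (main_var z b) = 0" by linarith
  then show False
  proof cases
    case 1
    have "a dvd 1"
      by (rule main_var_degree_0_unit[of z b a "[:r, Const e:]" 1])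
        (use assms m[unfolded ab(1) mult.commute[of a]] 1 in \<open>simp_all add: Const_dvd_1\<close>)
    with ab show False by blast
  next
    case 2
    have "b dvd 1"
      by (rule main_var_degree_0_unit[of z a b "[:r, Const e:]" 1])
        (use assms m[unfolded ab(1)] 2 in \<open>simp_all add: Const_dvd_1\<close>)
    with ab show False by blast
  qed
qed

lemma graded_mult: "graded (p * q) = graded p * graded q"
  and graded_Const: "graded (Const c) = [:Const c:]"
  by (simp_all add: ins_mult[OF Const_poly_hom] ins_Const[OF Const_poly_hom])

text \<open>A factorization of \<open>f - a y\<^sup>3 + b y\<close> yields a root \<open>s\<close>, so \<open>f = a s\<^sup>3 - b s\<close> and
  \<open>3 a s\<^sup>2 - b\<close> divides the gradient of \<open>f\<close>.\<close>
lemma not_reducible_cubic_in_var: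
  fixes f :: "'a::field_char_0 mpoly"
  assumes "a \<noteq> 0" "z \<notin> vars f" "unimodular_grad n f"
  shows "\<not> reducible (f - Const a * Var z ^ 3 + Const b * Var z)"
proof
  let ?g = "f - Const a * Var z ^ 3 + Const b * Var z"
  assume "reducible ?g"
  then obtain p q where pq: "?g = p * q" "\<not> p dvd 1" "\<not> q dvd 1"
    by (auto simp: reducible_def)
  interpret m: comm_ring_hom "main_var z" by (rule main_var_hom)
  have m: "main_var z ?g = [:f, Const b, 0, Const (- a):]"
    by (simp add: m.hom_add m.hom_minus m.hom_mult m.hom_power ins_Const[OF Const_poly_hom]
        ins_Var[OF Const_poly_hom] main_var_notin_vars[OF assms(2)] power3_eq_cube Const_uminus)
  then have mpq: "main_var z p * main_var z q = [:f, Const b, 0, Const (- a):]"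
    using pq(1) m.hom_mult[of p q] by simp
  moreover from this have "main_var z p \<noteq> 0" "main_var z q \<noteq> 0" using assms by auto
  ultimately have deg: "degree (main_var z p) + degree (main_var z q) = 3"
    using assms by (subst degree_mult_eq[symmetric]) auto
  have c3: "coeff [:f, Const b, 0, Const (- a):] 3 dvd 1"
    using assms(1) by (simp add: numeral_3_eq_3 Const_dvd_1)
  have np: "degree (main_var z p) \<noteq> 0"
    using main_var_degree_0_unit[OF m[unfolded pq(1) mult.commute[of p]] _ c3] pq assms(1) by auto
  have nq: "degree (main_var z q) \<noteq> 0"
    using main_var_degree_0_unit[OF m[unfolded pq(1)] _ c3] pq assms(1) by auto
  \<comment> \<open>A factor free of \<open>z\<close> would divide the constant \<open>- a\<close>,
    so the degrees in \<open>z\<close> are \<open>1\<close> and \<open>2\<close>.\<close>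
  from deg np nq have "degree (main_var z p) = 1 \<or> degree (main_var z q) = 1" by linarith
  then obtain h h' where h: "h * h' = [:f, Const b, 0, Const (- a):]" "degree h = 1"
    using that[of "main_var z p" "main_var z q"] that[of "main_var z q" "main_var z p"] mpq
    by (auto simp only: mult.commute[of "main_var z q"])
  have "degree h' = 2"
    using h assms(1) degree_mult_eq[of h h'] by (cases "h = 0 \<or> h' = 0") auto
  then have "coeff h 1 * coeff h' 2 = Const (- a)"
    using h coeff_degree_mult[of h h'] assms(1) by simp
  then have "coeff h 1 dvd 1"
    using assms(1) by (metis Const_dvd_1 dvd_trans dvd_triv_left neg_equal_0_iff_equal)
  then obtain h1 where h1: "coeff h 1 = Const h1" "h1 \<noteq> 0" by (rule unit_mpolyD)
  \<comment> \<open>The leading coefficients of the two factors multiply to the constant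
    \<open>- a\<close>, so \<open>h1\<close> is a constant and the root of the linear factor is
    again a polynomial.\<close>
  define s where "s = - (Const (inverse h1) * coeff h 0)"
  have "h = [:coeff h 0, Const h1:]"
    using h(2) h1 by (intro poly_eqI) (auto simp: coeff_pCons coeff_eq_0 split: nat.splits)
  then have "poly h s = poly [:coeff h 0, Const h1:] s" by (rule arg_cong)
  then have "poly h s = coeff h 0 + s * Const h1" by simp
  also have "\<dots> = coeff h 0 - Const (inverse h1 * h1) * coeff h 0"
    by (simp add: s_def Const_mult mult_ac)
  also have "\<dots> = 0" using h1(2) by simp
  finally have "poly ([:f, Const b, 0, Const (- a):]) s = 0"
    by (simp flip: h(1))
  then have f: "f = Const a * s ^ 3 - Const b * s"
    by (simp add: algebra_simps power3_eq_cube Const_uminus)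
  let ?u = "3 * Const a * s ^ 2 - Const b"
  have "pdiff j f = ?u * pdiff j s" for j
    unfolding f by (simp add: power3_eq_cube power2_eq_square algebra_simps)
  then have "?u dvd 1"
    by (intro unimodular_grad_dvd[OF assms(3) id_hom]) simp
  then obtain k where k: "?u = Const k" by (rule unit_mpolyD)
  have "3 * Const a * s ^ 2 = Const (k + b)"
    using k by (simp add: Const_add algebra_simps)
  then have "Const (3 * a) * (s * s) = Const (k + b)"
    by (simp add: Const_mult power2_eq_square)
  \<comment> \<open>The total degree of \<open>s * s\<close> is twice that of \<open>s\<close>, so a
    constant square forces a constant \<open>s\<close>.\<close>
  then have "graded (Const (3 * a) * (s * s)) = graded (Const (k + b))" by simp
  then have "[:Const (3 * a):] * (graded s * graded s) = [:Const (k + b):]"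
    by (simp only: graded_mult graded_Const)
  then have "degree ([:Const (3 * a):] * (graded s * graded s)) = 0" by simp
  then have "degree (graded s) = 0"
    using assms(1) by (cases "graded s = 0") (auto simp: degree_mult_eq)
  then have "s = Const (Poly_Mapping.lookup s 0)" by (rule degree_graded_eq_0)
  then obtain s0 where "s = Const s0" by blast
  then have "pdiff j s = 0" for j by simp
  then have "pdiff j f = 0" for j
    using \<open>\<And>j. pdiff j f = ?u * pdiff j s\<close> by simp
  then show False using assms(3) by (simp add: unimodular_grad_def)
qed

text \<open>Degrees in \<open>z\<close> add for nonzero factors, so a variable of a factor cannot
  cancel. This keeps the factors of a combination within the first \<open>n\<close>
  variables.\<close>

lemma vars_factor:
  fixes p q :: "'a::field_char_0 mpoly"
  assumes "p * q \<noteq> 0"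
  shows "vars p \<subseteq> vars (p * q)"
proof
  fix z assume z: "z \<in> vars p"
  show "z \<in> vars (p * q)"
  proof (rule ccontr)
    assume "z \<notin> vars (p * q)"
    then have "main_var z p * main_var z q = [:p * q:]"
      using main_var_notin_vars[of z "p * q"] ins_mult[OF Const_poly_hom, of _ p q] by simp
    moreover from this have "main_var z p \<noteq> 0" "main_var z q \<noteq> 0" using assms by auto
    ultimately have "degree (main_var z p) = 0"
      using degree_mult_eq[of "main_var z p" "main_var z q"] by simp
    then obtain r where r: "main_var z p = [:r:]" by (rule degree_eq_zeroE)
    then have "p = coeff (main_var z p) 0" using poly_main_var[of z p] by simp
    with z notin_vars_coeff_main_var[of z p 0] show False by simp
  qed
qed

text \<open>Evaluation respects congruence modulo \<open>d\<close>, by telescoping over the factors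
  of each monomial. With a linear form as \<open>d\<close>, a polynomial vanishing on its hyperplane
  turns out to be divisible by it.\<close>

lemma dvd_ins_diff:
  assumes "comm_ring_hom h" "\<And>i. d dvd X i - Y i"
  shows "d dvd ins h X p - ins h Y p"
proof -
  have pr: "d dvd prod f A - prod g A" if "\<And>i. d dvd f i - g i" for f g and A :: "nat set"
  proof (induction A rule: infinite_finite_induct)
    case (insert x A)
    have "f x * prod f A - g x * prod g A = (f x - g x) * prod f A + g x * (prod f A - prod g A)"
      by (simp add: algebra_simps)
    with insert that[of x] show ?case by simp
  qed simp_all
  have pw: "d dvd x ^ k - y ^ k" if "d dvd x - y" for x y k
    using pr[of "\<lambda>_. x" "\<lambda>_. y" "{..<k}"] that by simp
  have "d dvd mval X m - mval Y m" for m
    unfolding mval_def by (intro pr pw assms(2))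
  then have "d dvd (\<Sum>m\<in>Poly_Mapping.keys p. h (Poly_Mapping.lookup p m) * (mval X m - mval Y m))"
    by (intro dvd_sum) simp
  then show ?thesis
    by (simp add: ins_def right_diff_distrib sum_subtractf)
qed

section \<open>Linear forms under derivatives and evaluations\<close>

lemma linform_smult: "linform n (\<lambda>i. c * l i) = Const c * linform n l"
  by (simp add: linform_def Const_mult mult.assoc sum_distrib_left)

lemma pdiff_linform: "pdiff j (linform n l) = (if j < n then Const (l j) else 0)"
proof -
  have "pdiff j (linform n l) = (\<Sum>i<n. if i = j then Const (l i) else 0)"
    by (simp add: linform_def if_distrib[of "\<lambda>x. _ * x"] cong: if_cong)
  then show ?thesis by simp
qed

lemma ins_linform:
  "ins (\<lambda>c. [:Const c:]) (\<lambda>i. [:Const (p i), X i:]) (linform n l)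
    = [:Const (\<Sum>i<n. l i * p i), subst (linform n l) X:]"
proof -
  have "(\<Sum>i\<in>A. [:f i, g i:]) = [:sum f A, sum g A:]" for f g :: "nat \<Rightarrow> 'a mpoly" and A
    by (induction A rule: infinite_finite_induct) simp_all
  then show ?thesis
    by (simp add: linform_def ins_sum[OF Const_poly_hom] ins_mult[OF Const_poly_hom]
        ins_Const[OF Const_poly_hom] ins_Var[OF Const_poly_hom] Const_sum Const_mult mult.commute)
qed

lemma graded_linform: "graded (linform n l) = [:0, linform n l:]"
  using ins_linform[of "\<lambda>_. 0" Var n l] by (simp add: subst_Var_id)

lemma sum_eq_single:
  fixes g :: "'b \<Rightarrow> 'c::comm_ring_1"
  assumes "finite S" "i \<in> S" "\<And>s. s \<in> S \<Longrightarrow> s \<noteq> i \<Longrightarrow> g s = 0"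
  shows "sum g S = g i"
  using assms by (subst sum.remove[of S i]) (auto intro!: sum.neutral)

lemma sum_eq_pair:
  fixes g :: "'b \<Rightarrow> 'c::comm_ring_1"
  assumes "finite S" "i \<in> S" "j \<in> S" "i \<noteq> j" "\<And>s. s \<in> S \<Longrightarrow> s \<noteq> i \<Longrightarrow> s \<noteq> j \<Longrightarrow> g s = 0"
  shows "sum g S = g i + g j"
proof -
  have "sum g S = sum g {i, j}"
    by (rule sum.mono_neutral_right) (use assms in auto)
  then show ?thesis using assms by simp
qed

subsection \<open>Dependent components with square factors\<close>

text \<open>The components of the map are \<open>L\<^sub>s + L\<^sub>s\<^sup>2 \<rho>\<^sub>s\<close>. Assumption \<open>dep\<close> forces \<open>\<rho>\<^sub>s\<close> to depend only on the
  forms \<open>L\<^sub>q\<close>. Assumption \<open>jac\<close> then says that along the line \<open>t (\<alpha> w\<^sub>i + \<beta> w\<^sub>j)\<close> the Jacobian has an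
  invertible 2x2 block; its determinant is \<open>1 + A t\<^sup>2 + B t\<^sup>4\<close>, so \<open>A = B = 0\<close> for all \<open>\<alpha>\<close> and \<open>\<beta>\<close>.\<close>
lemma squares_times_linear_forms_vanish:
  fixes L \<rho> :: "'s \<Rightarrow> (nat \<Rightarrow> 'a::field_char_0 poly) \<Rightarrow> 'a poly" and \<sigma> :: "(nat \<Rightarrow> 'a poly) \<Rightarrow> 'a poly"
    and r :: "'s \<Rightarrow> 's \<Rightarrow> 'a" and w :: "'s \<Rightarrow> nat \<Rightarrow> 'a poly"
  assumes S: "finite S" and t: "\<And>s. s \<in> S \<Longrightarrow> t s \<noteq> 0"
    and L_add: "\<And>s x y. L s (\<lambda>i. x i + y i) = L s x + L s y"
    and L_smult: "\<And>s a x. L s (\<lambda>i. a * x i) = a * L s x"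
    and \<rho>_add: "\<And>s x y. \<rho> s (\<lambda>i. x i + y i) = \<rho> s x + \<rho> s y"
    and \<rho>_smult: "\<And>s a x. \<rho> s (\<lambda>i. a * x i) = a * \<rho> s x"
    and \<sigma>_add: "\<And>x y. \<sigma> (\<lambda>i. x i + y i) = \<sigma> x + \<sigma> y"
    and dep: "\<And>x. (\<Sum>s\<in>S. [:t s:] * (L s x ^ 2 * \<rho> s x)) = (\<Sum>s\<in>S. [:t s:] * L s x) ^ 2 * \<sigma> x"
    and jac: "\<And>x q. q \<in> S \<Longrightarrow> \<exists>y. \<forall>s\<in>S. (1 + 2 * L s x * \<rho> s x) * L s y + L s x ^ 2 * \<rho> s y = (if s = q then 1 else 0)"
    and w: "\<And>s q. s \<in> S \<Longrightarrow> q \<in> S \<Longrightarrow> L s (w q) = (if s = q then 1 else 0)"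
    and r: "\<And>s q. s \<in> S \<Longrightarrow> q \<in> S \<Longrightarrow> \<rho> s (w q) = [:r s q:]"
    and two: "\<And>i. i \<in> S \<Longrightarrow> \<exists>j\<in>S. j \<noteq> i"
    and i: "i \<in> S"
  shows "\<rho> i x = 0"
proof -
  have vanish: "\<rho> i v = 0" if v: "\<And>s. s \<in> S \<Longrightarrow> L s v = 0" and i: "i \<in> S" for i v
  proof -
    obtain j where j: "j \<in> S" "j \<noteq> i" using two i by blast
    have *: "[:t i:] * \<rho> i v = [:t i:] ^ 2 * \<sigma> v" if i: "i \<in> S" for i
    proof -
      have Li: "L s (w i) = (if s = i then 1 else 0)" "L s (\<lambda>k. w i k + v k) = (if s = i then 1 else 0)"
        if "s \<in> S" for s using that i v[OF that] w[OF that i] by (simp_all add: L_add)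
      have "[:t i:] * \<rho> i x = [:t i:] ^ 2 * \<sigma> x" if "\<And>s. s \<in> S \<Longrightarrow> L s x = (if s = i then 1 else 0)" for x
        using dep[of x] sum_eq_single[OF S i, of "\<lambda>s. [:t s:] * (L s x ^ 2 * \<rho> s x)"]
          sum_eq_single[OF S i, of "\<lambda>s. [:t s:] * L s x"] that i by (simp add: zero_power)
      \<comment> \<open>Moving \<open>w i\<close> by \<open>v\<close> changes no \<open>L s\<close>,
        so the difference of the two instances of \<open>dep\<close> is the same equation for
        \<open>\<rho> i v\<close> and \<open>\<sigma> v\<close>.\<close>
      from this[of "w i"] this[of "\<lambda>k. w i k + v k"] Li show ?thesis
        by (simp add: \<rho>_add \<sigma>_add distrib_left del: mult_pCons_left)
    qed
    have pair: "[:t i:] * \<rho> i v + [:t j:] * \<rho> j v = ([:t i:] + [:t j:]) ^ 2 * \<sigma> v"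
    proof -
      let ?x = "\<lambda>k. w i k + w j k" and ?y = "\<lambda>k. (w i k + w j k) + v k"
      have Lij: "L s ?x = (if s = i \<or> s = j then 1 else 0)" "L s ?y = (if s = i \<or> s = j then 1 else 0)"
        if "s \<in> S" for s
        using that i j v[OF that] w[OF that i] w[OF that j(1)] by (simp_all add: L_add)
      have "[:t i:] * \<rho> i x + [:t j:] * \<rho> j x = ([:t i:] + [:t j:]) ^ 2 * \<sigma> x"
        if "\<And>s. s \<in> S \<Longrightarrow> L s x = (if s = i \<or> s = j then 1 else 0)" for x
        using dep[of x] sum_eq_pair[OF S i j(1) j(2)[symmetric], of "\<lambda>s. [:t s:] * (L s x ^ 2 * \<rho> s x)"]
          sum_eq_pair[OF S i j(1) j(2)[symmetric], of "\<lambda>s. [:t s:] * L s x"] that i j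
        by (simp add: zero_power del: mult_pCons_left)
      from this[of ?x, OF Lij(1)] this[of ?y, OF Lij(2)] show ?thesis
        unfolding \<rho>_add[of _ ?x v] \<sigma>_add[of ?x v]
        by (simp add: distrib_left add_ac del: mult_pCons_left add_pCons)
    qed
    have "(a + b)\<^sup>2 * c = a\<^sup>2 * c + b\<^sup>2 * c + 2 * a * b * c" for a b c :: "'a poly"
      by (simp add: power2_eq_square algebra_simps)
    \<comment> \<open>Along \<open>w i\<close>, \<open>w j\<close> and their sum,
      \<open>\<sigma> v\<close> occurs with the squares of \<open>t i\<close>, \<open>t j\<close>
      and \<open>t i + t j\<close>. Only the cross term survives the comparison, and it must
      vanish.\<close>
    from pair[unfolded this *[OF i] *[OF j(1)]] have "2 * [:t i:] * [:t j:] * \<sigma> v = 0"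
      by (simp only: add_cancel_right_right)
    with t[OF i] t[OF j(1)] have "\<sigma> v = 0" by simp
    with *[OF i] t[OF i] show ?thesis by simp
  qed
  have zero: "L s (\<lambda>_. 0) = 0" "\<rho> s (\<lambda>_. 0) = 0" for s
    using L_smult[of s 0 "\<lambda>_. 0"] \<rho>_smult[of s 0 "\<lambda>_. 0"] by simp_all
  have L_sum: "L s (\<lambda>k. \<Sum>q\<in>A. f q k) = (\<Sum>q\<in>A. L s (f q))"
    and \<rho>_sum: "\<rho> s (\<lambda>k. \<Sum>q\<in>A. f q k) = (\<Sum>q\<in>A. \<rho> s (f q))" for s A and f :: "'s \<Rightarrow> nat \<Rightarrow> 'a poly"
    by (induction A rule: infinite_finite_induct) (simp_all add: zero L_add \<rho>_add)
  have expand: "\<rho> i x = (\<Sum>s\<in>S. L s x * [:r i s:])" if i: "i \<in> S" for i x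
  proof -
    \<comment> \<open>Removing the part of \<open>x\<close> along the vectors \<open>w q\<close>,
      which are dual to the forms \<open>L q\<close>, leaves a vector on which every
      \<open>L s\<close> vanishes.\<close>
    let ?z = "\<lambda>k. \<Sum>q\<in>S. L q x * w q k" and ?v = "\<lambda>k. x k + (- 1) * (\<Sum>q\<in>S. L q x * w q k)"
    have "L s ?z = L s x" if "s \<in> S" for s
      using that S by (simp add: L_sum L_smult w if_distrib[of "\<lambda>x. _ * x"] cong: if_cong)
    then have "L s ?v = 0" if "s \<in> S" for s
      using that by (simp only: L_add L_smult) simp
    then have "\<rho> i ?v = 0" using vanish i by blast
    then have "\<rho> i x = \<rho> i ?z" by (simp only: \<rho>_add \<rho>_smult) simp
    also have "\<dots> = (\<Sum>s\<in>S. L s x * [:r i s:])"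
      using i by (simp add: \<rho>_sum \<rho>_smult r)
    finally show ?thesis .
  qed
  have key: "3 * \<alpha>\<^sup>2 * r i i + 2 * \<alpha> * \<beta> * r i j + 3 * \<beta>\<^sup>2 * r j j + 2 * \<alpha> * \<beta> * r j i = 0 \<and>
      (3 * \<alpha>\<^sup>2 * r i i + 2 * \<alpha> * \<beta> * r i j) * (3 * \<beta>\<^sup>2 * r j j + 2 * \<alpha> * \<beta> * r j i) - \<alpha>\<^sup>2 * \<beta>\<^sup>2 * r i j * r j i = 0"
    if i: "i \<in> S" and j: "j \<in> S" and ij: "i \<noteq> j" for i j and \<alpha> \<beta> :: 'a
  proof -
    let ?T = "[:0, 1:] :: 'a poly"
    \<comment> \<open>\<open>?T\<close> is the parameter of the line. Polynomial coordinates turn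
      invertibility of the Jacobian along the line into a unit among univariate polynomials.\<close>
    define x where "x k = (?T * [:\<alpha>:]) * w i k + (?T * [:\<beta>:]) * w j k" for k
    have Lx: "L s x = (if s = i then ?T * [:\<alpha>:] else if s = j then ?T * [:\<beta>:] else 0)" if "s \<in> S" for s
      unfolding x_def L_add L_smult using that i j ij by (simp add: w)
    have \<rho>x: "\<rho> s x = ?T * ([:\<alpha>:] * [:r s i:] + [:\<beta>:] * [:r s j:])" if "s \<in> S" for s
      unfolding x_def \<rho>_add \<rho>_smult using that i j by (simp add: r)
    obtain y where y: "\<And>q s. q \<in> {i, j} \<Longrightarrow> s \<in> S \<Longrightarrow>
        (1 + 2 * L s x * \<rho> s x) * L s (y q) + L s x ^ 2 * \<rho> s (y q) = (if s = q then 1 else 0)"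
    proof -
      have "\<forall>q\<in>{i, j}. \<exists>y. \<forall>s\<in>S. (1 + 2 * L s x * \<rho> s x) * L s y + L s x ^ 2 * \<rho> s y = (if s = q then 1 else 0)"
        using i j jac by blast
      then show ?thesis using that by (metis (no_types, lifting) bchoice)
    qed
    \<comment> \<open>For the other \<open>s\<close>, \<open>L s\<close> vanishes at
      \<open>x\<close>, so row \<open>s\<close> of the inverse relation reduces to
      \<open>L s (y q) = 0\<close>. This cuts the relation down to the rows and columns
      \<open>i\<close> and \<open>j\<close>.\<close>
    have Ly: "L s (y q) = 0" if "q \<in> {i, j}" "s \<in> S" "s \<noteq> i" "s \<noteq> j" for q s
      using y[OF that(1,2)] that by (auto simp: Lx)
    have \<rho>y: "\<rho> s (y q) = L i (y q) * [:r s i:] + L j (y q) * [:r s j:]" if "q \<in> {i, j}" "s \<in> S" for q s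
      unfolding expand[OF that(2)] using that Ly by (intro sum_eq_pair[OF S i j ij]) auto
    define a where "a = 1 + 2 * (?T * [:\<alpha>:]) * (?T * ([:\<alpha>:] * [:r i i:] + [:\<beta>:] * [:r i j:])) + (?T * [:\<alpha>:])\<^sup>2 * [:r i i:]"
    define b where "b = (?T * [:\<alpha>:])\<^sup>2 * [:r i j:]"
    define c where "c = (?T * [:\<beta>:])\<^sup>2 * [:r j i:]"
    define d where "d = 1 + 2 * (?T * [:\<beta>:]) * (?T * ([:\<alpha>:] * [:r j i:] + [:\<beta>:] * [:r j j:])) + (?T * [:\<beta>:])\<^sup>2 * [:r j j:]"
    have e1: "a * L i (y q) + b * L j (y q) = (if i = q then 1 else 0)" if "q \<in> {i, j}" for q
      using y[OF that i] \<rho>y[OF that i] Lx[OF i] \<rho>x[OF i]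
      by (simp add: a_def b_def algebra_simps del: mult_pCons_left mult_pCons_right add_pCons)
    have e2: "c * L i (y q) + d * L j (y q) = (if j = q then 1 else 0)" if "q \<in> {i, j}" for q
      using y[OF that j] \<rho>y[OF that j] Lx[OF j] \<rho>x[OF j] ij
      by (simp add: c_def d_def algebra_simps del: mult_pCons_left mult_pCons_right add_pCons)
    \<comment> \<open>Multiplicativity of 2x2 determinants: the values of \<open>L i\<close> and
      \<open>L j\<close> at \<open>y i\<close> and \<open>y j\<close> form a right inverse of the
      matrix with rows \<open>a, b\<close> and \<open>c, d\<close>.\<close>
    have "(a * d - b * c) * (L i (y i) * L j (y j) - L i (y j) * L j (y i)) =
       (a * L i (y i) + b * L j (y i)) * (c * L i (y j) + d * L j (y j))
      - (a * L i (y j) + b * L j (y j)) * (c * L i (y i) + d * L j (y i))"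
      by (simp add: algebra_simps)
    also have "\<dots> = 1" using e1 e2 ij by simp
    finally have "a * d - b * c dvd 1" by (metis dvd_triv_left)
    then have "degree (a * d - b * c) = 0" by (auto simp: is_unit_poly_iff)
    moreover have "a * d - b * c = [:1, 0, 3 * \<alpha>\<^sup>2 * r i i + 2 * \<alpha> * \<beta> * r i j + 3 * \<beta>\<^sup>2 * r j j + 2 * \<alpha> * \<beta> * r j i, 0,
      (3 * \<alpha>\<^sup>2 * r i i + 2 * \<alpha> * \<beta> * r i j) * (3 * \<beta>\<^sup>2 * r j j + 2 * \<alpha> * \<beta> * r j i) - \<alpha>\<^sup>2 * \<beta>\<^sup>2 * r i j * r j i:]"
      by (simp add: a_def b_def c_def d_def power2_eq_square one_pCons numeral_poly algebra_simps)
    ultimately show ?thesis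
      by (simp split: if_splits)
  qed
  \<comment> \<open>The directions \<open>(1, 0)\<close> and \<open>(0, 1)\<close> remove the
    diagonal entries. Direction \<open>(1, 1)\<close> then gives \<open>r i s + r s i = 0\<close>
    and \<open>3 * r i s * r s i = 0\<close>.\<close>
  have "r i s = 0" if s: "s \<in> S" for s
  proof (cases "s = i")
    case True
    obtain j where "j \<in> S" "j \<noteq> i" using two i by blast
    with key[OF i, of j 1 0] True show ?thesis by simp
  next
    case False
    have "r i i = 0" "r s s = 0"
      using key[OF i s False[symmetric], of 1 0] key[OF i s False[symmetric], of 0 1] by simp_all
    with key[OF i s False[symmetric], of 1 1]
    have *: "2 * r i s + 2 * r s i = 0" "(2 * r i s) * (2 * r s i) - r i s * r s i = 0"
      by simp_all
    have "r i s + r s i = (2 * r i s + 2 * r s i) / 2" by (simp add: add_divide_distrib)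
    with *(1) have "r i s + r s i = 0" by (simp only: div_0)
    then have "r s i = - r i s" by (simp add: eq_neg_iff_add_eq_0 add.commute)
    with *(2) have "3 * (r i s * r i s) = 0" by simp
    then show ?thesis by simp
  qed
  then show ?thesis by (simp add: expand[OF i])
qed

text \<open>On the hyperplane where the linear factor of \<open>f\<close> vanishes, the gradient of \<open>f\<close> is a multiple of
  the other factor, which is therefore a nonzero constant there.\<close>
lemma reducible_cubic_form:
  fixes f :: "'a::field_char_0 mpoly"
  assumes uni: "unimodular_grad n f" and vf: "vars f \<subseteq> {..<n}"
    and d3: "degree (graded f) \<le> 3" and c2: "coeff (graded f) 2 = 0" and red: "reducible f"
  obtains l r where "f = linform n l + linform n l ^ 2 * linform n r" "linform n l ^ 2 * linform n r \<noteq> 0"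
proof -
  obtain P Q where PQ: "f = P * Q" "degree (graded P) = 1" "degree (graded Q) = 2"
  proof -
    obtain P Q where PQ: "f = P * Q" "\<not> P dvd 1" "\<not> Q dvd 1"
      using red by (auto simp: reducible_def)
    have nz: "f \<noteq> 0" using uni by (auto simp: unimodular_grad_def)
    have pos: "degree (graded p) \<noteq> 0" if "\<not> p dvd 1" "p \<noteq> 0" for p :: "'a mpoly"
      using degree_graded_eq_0[of p] that by (metis Const_dvd_1 Const_0)
    have g: "graded f = graded P * graded Q" by (simp add: PQ(1) graded_mult)
    have gnz: "graded f \<noteq> 0" using nz poly_graded_1[of f] by auto
    have sum: "degree (graded f) = degree (graded P) + degree (graded Q)"
      using gnz g by (metis degree_mult_eq mult_zero_left mult_zero_right)
    \<comment> \<open>Both factors have positive degree, and the total is at most \<open>3\<close>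
      but not \<open>2\<close>, as the quadratic part vanishes; so one factor is linear and the
      other quadratic.\<close>
    have "degree (graded f) \<noteq> 2" using c2 gnz by (metis leading_coeff_0_iff)
    moreover have "degree (graded P) \<noteq> 0" "degree (graded Q) \<noteq> 0"
      using pos[of P] pos[of Q] PQ nz by auto
    ultimately have "degree (graded P) = 1 \<and> degree (graded Q) = 2 \<or> degree (graded P) = 2 \<and> degree (graded Q) = 1"
      using sum d3 by linarith
    then show ?thesis using that PQ(1) by (metis mult.commute)
  qed
  have nz: "P * Q \<noteq> 0" using uni PQ(1) by (auto simp: unimodular_grad_def)
  have vP: "vars P \<subseteq> {..<n}" and vQ: "vars Q \<subseteq> {..<n}"
    using vars_factor[of P Q] vars_factor[of Q P] nz vf PQ(1) by (auto simp: mult.commute)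
  define \<beta> where "\<beta> = Poly_Mapping.lookup P 0"
  define q0 where "q0 = Poly_Mapping.lookup Q 0"
  obtain l where l: "coeff (graded P) 1 = linform n l"
    by (rule coeff_1_graded[OF vP])
  obtain q1 where q1: "coeff (graded Q) 1 = linform n q1"
    by (rule coeff_1_graded[OF vQ])
  define q2 where "q2 = coeff (graded Q) 2"
  let ?l = "linform n l" and ?q1 = "linform n q1"
  have gP: "graded P = [:Const \<beta>, ?l:]"
    using PQ(2) l coeff_0_graded[of P]
    by (intro poly_eqI) (auto simp: coeff_pCons \<beta>_def coeff_eq_0 split: nat.splits)
  have gQ: "graded Q = [:Const q0, ?q1, q2:]"
    using PQ(3) q1 coeff_0_graded[of Q]
    by (intro poly_eqI) (auto simp: coeff_pCons q0_def q2_def coeff_eq_0 numeral_2_eq_2 split: nat.splits)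
  have P: "P = Const \<beta> + ?l" using poly_graded_1[of P] gP by simp
  have Q: "Q = Const q0 + ?q1 + q2" using poly_graded_1[of Q] gQ by (simp add: algebra_simps)
  have l_nz: "?l \<noteq> 0" and q2_nz: "q2 \<noteq> 0" using PQ gP gQ by (auto split: if_splits)
  have quad: "Const \<beta> * q2 + ?l * ?q1 = 0"
    using c2 PQ(1) gP gQ by (simp add: graded_mult numeral_2_eq_2 algebra_simps)
  have gq2: "graded q2 = monom q2 2" unfolding q2_def by (rule graded_coeff_graded)
  have vq2: "vars q2 \<subseteq> {..<n}" unfolding q2_def using vars_coeff_graded vQ by blast
  obtain k where k: "k < n" "l k \<noteq> 0"
    using l_nz unfolding linform_def by (auto elim!: sum.not_neutral_contains_not_neutral)
  \<comment> \<open>Projection onto the hyperplane \<open>?l = 0\<close> along a coordinate with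
    \<open>l k \<noteq> 0\<close>. It changes the variables by multiples of \<open>?l\<close> only,
    so whatever it annihilates is divisible by \<open>?l\<close>.\<close>
  define X0 where "X0 i = Var i - (if i = k then Const (inverse (l k)) * ?l else 0)" for i
  have sl: "subst ?l X0 = 0"
  proof -
    have "subst ?l X0 = ?l - (\<Sum>i<n. if i = k then Const (l i) * (Const (inverse (l i)) * ?l) else 0)"
      unfolding X0_def linform_def
      by (simp add: right_diff_distrib sum_subtractf if_distrib[of "\<lambda>x. _ * x"] cong: if_cong)
    also have "\<dots> = ?l - Const (l k) * (Const (inverse (l k)) * ?l)"
      using k by simp
    also have "\<dots> = ?l - Const (l k * inverse (l k)) * ?l"
      by (simp only: Const_mult mult.assoc)
    finally show ?thesis using k by simp
  qed
  have dvd: "?l dvd p" if "subst p X0 = 0" for p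
  proof -
    have "?l dvd ins Const Var p - ins Const X0 p"
      by (rule dvd_ins_diff[OF Const_hom]) (simp add: X0_def)
    with that show ?thesis by (simp add: ins_Var_id subst_ins)
  qed
  have pd: "pdiff j f = P * pdiff j Q + pdiff j P * Q" for j by (simp add: PQ(1))
  have unit: "E Q dvd 1" if "comm_ring_hom E" "E P = 0" for E :: "'a mpoly \<Rightarrow> 'a mpoly poly"
  proof (rule unimodular_grad_dvd[OF uni that(1)])
    interpret comm_ring_hom E by fact
    show "E Q dvd E (pdiff j f)" for j by (simp add: pd hom_add hom_mult that(2))
  qed
  show ?thesis
  proof (cases "\<beta> = 0")
    case True
    with quad l_nz have q1_0: "?q1 = 0" by simp
    \<comment> \<open>The point \<open>t X0\<close> stays on the hyperplane where \<open>P\<close>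
      vanishes. There \<open>Q\<close> is \<open>q0\<close> plus \<open>t^2\<close> times the value
      of \<open>q2\<close> at \<open>X0\<close>; as a unit it is free of \<open>t\<close>, so
      \<open>?l\<close> divides \<open>q2\<close>.\<close>
    define E where "E = ins (\<lambda>c :: 'a. [:Const c:]) (\<lambda>i. [:0, X0 i:])"
    have "E ?l = 0"
      using ins_linform[of "\<lambda>_. 0" X0 n l] sl by (simp add: E_def)
    then have "E P = 0" by (simp add: P True)
    then have "E Q dvd 1"
      by (intro unit) (simp_all add: E_def ins_hom[OF Const_poly_hom])
    moreover have EQ: "E Q = [:Const q0:] + monom (subst q2 X0) 2"
      unfolding Q q1_0 E_def
      using ins_scaled_coeff_graded[of X0 Q 2]
      by (simp add: ins_add[OF Const_poly_hom] ins_Const[OF Const_poly_hom] q2_def)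
    ultimately have "degree (E Q) = 0" by (auto simp: is_unit_poly_iff)
    then have "coeff (E Q) 2 = 0" by (simp add: coeff_eq_0)
    then have s2: "subst q2 X0 = 0" by (simp add: EQ numeral_2_eq_2)
    with EQ \<open>E Q dvd 1\<close> have q0: "q0 \<noteq> 0" by auto
    from dvd[OF s2] obtain \<rho> where \<rho>: "q2 = ?l * \<rho>" by (elim dvdE)
    then have "monom q2 2 = [:0, ?l:] * graded \<rho>"
      using gq2 by (simp add: \<rho> graded_mult graded_linform)
    then have "coeff (monom q2 2) 2 = coeff ([:0, ?l:] * graded \<rho>) 2" by simp
    then have q2: "q2 = ?l * coeff (graded \<rho>) 1" by (simp add: numeral_2_eq_2)
    have "vars \<rho> \<subseteq> {..<n}"
      using vars_factor[of \<rho> ?l] \<rho> q2_nz vq2 by (simp add: mult.commute)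
    then obtain r where r: "coeff (graded \<rho>) 1 = linform n r"
      by (rule coeff_1_graded)
    \<comment> \<open>Here \<open>f\<close> is \<open>q0 l + l^2 r\<close>. Taking the whole linear
      part \<open>q0 l\<close> as the new form costs a factor \<open>q0^-2\<close> in the other
      one.\<close>
    let ?l' = "linform n (\<lambda>i. q0 * l i)" and ?r' = "linform n (\<lambda>i. inverse q0 ^ 2 * r i)"
    have "?l' ^ 2 * ?r' = Const (q0 ^ 2 * inverse q0 ^ 2) * (?l * q2)"
      by (simp add: linform_smult q2[unfolded r] power_mult_distrib Const_mult Const_power power2_eq_square algebra_simps)
    also have "\<dots> = ?l * q2" using q0 by (simp flip: power_mult_distrib)
    finally have lr: "?l' ^ 2 * ?r' = ?l * q2" .
    moreover have "f = ?l' + ?l * q2"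
      using PQ(1) by (simp add: P Q True q1_0 linform_smult algebra_simps)
    ultimately show ?thesis using that[of "\<lambda>i. q0 * l i" "\<lambda>i. inverse q0 ^ 2 * r i"] l_nz q2_nz by simp
  next
    case False
    \<comment> \<open>A point of the affine hyperplane \<open>?l = - \<beta>\<close> on a coordinate
      axis; \<open>P\<close> vanishes along \<open>p + t X0\<close>.\<close>
    define p where "p i = (if i = k then - \<beta> * inverse (l k) else 0)" for i
    define E where "E = ins (\<lambda>c :: 'a. [:Const c:]) (\<lambda>i. [:Const (p i), X0 i:])"
    interpret E: comm_ring_hom E unfolding E_def by (rule ins_hom[OF Const_poly_hom])
    have EC: "E (Const c) = [:Const c:]" for c
      by (simp add: E_def ins_Const[OF Const_poly_hom])
    have "(\<Sum>i<n. l i * p i) = - \<beta>"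
      using k by (simp add: p_def if_distrib[of "\<lambda>x. _ * x"] cong: if_cong)
    then have El: "E ?l = [:- Const \<beta>:]"
      using ins_linform[of p X0 n l] sl by (simp add: E_def Const_uminus)
    then have "E P = 0" by (simp add: P E.hom_add EC)
    then have "E Q dvd 1" by (intro unit E.comm_ring_hom_axioms)
    have q2: "q2 = - (Const (inverse \<beta>) * ?l * ?q1)"
    proof -
      have "Const (inverse \<beta>) * (Const \<beta> * q2 + ?l * ?q1) = 0" using quad by simp
      then have "Const (inverse \<beta> * \<beta>) * q2 + Const (inverse \<beta>) * ?l * ?q1 = 0"
        by (simp add: Const_mult algebra_simps)
      with False show ?thesis by (simp add: eq_neg_iff_add_eq_0)
    qed
    \<comment> \<open>Replacing \<open>q2\<close> through \<open>quad\<close> and \<open>?l\<close>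
      by \<open>- \<beta>\<close> produces a second copy of \<open>?q1\<close>. The result is linear
      in \<open>t\<close>, and being a unit it has no slope, so \<open>?q1\<close> vanishes on
      \<open>?l = 0\<close>.\<close>
    have EQ: "E Q = [:Const q0:] + 2 * E ?q1"
    proof -
      have "[:Const (inverse \<beta>):] * [:- Const \<beta>:] = (- 1 :: 'a mpoly poly)"
        using False by (simp add: one_pCons flip: Const_mult)
      moreover have "E Q = [:Const q0:] + E ?q1 + - ([:Const (inverse \<beta>):] * [:- Const \<beta>:] * E ?q1)"
        by (simp only: Q q2 E.hom_add E.hom_uminus E.hom_mult EC El)
      ultimately have "E Q = [:Const q0:] + E ?q1 + - (- 1 * E ?q1)" by (simp only:)
      then show ?thesis by simp
    qed
    obtain e where Eq1: "E ?q1 = [:e, subst ?q1 X0:]"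
      using ins_linform[of p X0 n q1] unfolding E_def by blast
    from \<open>E Q dvd 1\<close> have "degree (E Q) = 0" by (auto simp: is_unit_poly_iff)
    then have "coeff (E Q) 1 = 0" by (simp add: coeff_eq_0)
    moreover have "E Q = [:Const q0:] + (E ?q1 + E ?q1)" by (simp only: EQ mult_2)
    then have "coeff (E Q) 1 = 2 * subst ?q1 X0" by (simp add: Eq1)
    ultimately have "subst ?q1 X0 = 0" by simp
    from dvd[OF this] obtain \<kappa>' where "?q1 = ?l * \<kappa>'" by (elim dvdE)
    then have "graded ?q1 = graded (?l * \<kappa>')" by simp
    then have "[:0, ?q1:] = [:0, ?l:] * graded \<kappa>'"
      by (simp only: graded_mult graded_linform)
    then have "coeff [:0, ?q1:] 1 = coeff ([:0, ?l:] * graded \<kappa>') 1" by simp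
    then have "?q1 = ?l * coeff (graded \<kappa>') 0" by simp
    then have "?q1 = Const (Poly_Mapping.lookup \<kappa>' 0) * ?l"
      unfolding coeff_0_graded by (subst mult.commute)
    then obtain \<kappa> where \<kappa>: "?q1 = Const \<kappa> * ?l" by blast
    define c where "c = inverse \<beta> * \<kappa>"
    have \<kappa>c: "Const \<kappa> = Const \<beta> * Const c" using False by (simp add: c_def flip: Const_mult)
    have q2c: "q2 = - (Const c * ?l ^ 2)"
      by (simp add: q2 \<kappa> c_def Const_mult power2_eq_square algebra_simps)
    \<comment> \<open>Both \<open>?q1\<close> and \<open>q2\<close> are now polynomials in
      \<open>?l\<close>, hence \<open>f\<close> is a univariate cubic in \<open>?l\<close> whose
      derivative \<open>?u\<close> divides the gradient. A constant \<open>?u\<close> means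
      \<open>c = 0\<close> and so \<open>q2 = 0\<close>, a contradiction.\<close>
    let ?u = "Const \<beta> * Const \<kappa> + Const q0 - 3 * Const c * ?l ^ 2"
    have "pdiff j f = ?u * pdiff j ?l" for j
      unfolding PQ(1) P Q \<kappa> q2c \<kappa>c
      by (simp add: power2_eq_square algebra_simps)
    then have "?u dvd 1"
      by (intro unimodular_grad_dvd[OF uni id_hom]) simp
    then obtain d where d: "?u = Const d" by (rule unit_mpolyD)
    have "Const (3 * c) * (?l * ?l) = Const (\<beta> * \<kappa> + q0 - d)"
      using d by (simp add: Const_mult Const_add Const_diff power2_eq_square algebra_simps)
    then have "graded (Const (3 * c) * (?l * ?l)) = graded (Const (\<beta> * \<kappa> + q0 - d))" by simp
    then have "[:Const (3 * c):] * ([:0, ?l:] * [:0, ?l:]) = [:Const (\<beta> * \<kappa> + q0 - d):]"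
      by (simp only: graded_mult graded_linform graded_Const)
    then have "coeff ([:Const (3 * c):] * ([:0, ?l:] * [:0, ?l:])) 2 = coeff [:Const (\<beta> * \<kappa> + q0 - d):] 2"
      by (rule arg_cong)
    then have "Const (3 * c) * (?l * ?l) = 0" by (auto simp: numeral_2_eq_2)
    then have "c = 0" using l_nz by auto
    with q2c q2_nz show ?thesis by simp
  qed
qed

subsection \<open>The choice of \<open>\<lambda>\<close>\<close>

lemma sum_fun_apply: "sum f A x = (\<Sum>a\<in>A. f a x)" for f :: "'c \<Rightarrow> 'd \<Rightarrow> 'e::comm_monoid_add"
  by (induction A rule: infinite_finite_induct) simp_all

lemma vector_space_fun: "vector_space (\<lambda>(a :: 'a::field) f (i :: nat). a * f i)"
  by unfold_locales (simp_all add: fun_eq_iff algebra_simps)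

lemma vector_space_mult: "vector_space ((*) :: 'a::field \<Rightarrow> 'a \<Rightarrow> 'a)"
  by unfold_locales (simp_all add: algebra_simps)

text \<open>Extend \<open>\<phi>\<close> to a linear functional. On vectors supported below
  \<open>n\<close> it is the pairing with its values at the unit vectors.\<close>

lemma independent_dual_vector:
  fixes B :: "(nat \<Rightarrow> 'a::field) set"
  assumes indep: "\<not> module.dependent (\<lambda>a f i. a * f i) B"
    and supp: "\<And>b i. b \<in> B \<Longrightarrow> i \<ge> n \<Longrightarrow> b i = 0"
  shows "\<exists>d. \<forall>b\<in>B. (\<Sum>i<n. b i * d i) = \<phi> b"
proof -
  interpret P: vector_space_pair "\<lambda>(a :: 'a) f (i :: nat). a * f i" "(*) :: 'a \<Rightarrow> 'a \<Rightarrow> 'a"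
    unfolding vector_space_pair_def by (intro conjI vector_space_fun vector_space_mult)
  obtain g where g: "Vector_Spaces.linear (\<lambda>a f i. a * f i) (*) g" "\<And>b. b \<in> B \<Longrightarrow> g b = \<phi> b"
    using P.linear_independent_extend[OF indep, of \<phi>] by blast
  interpret g: Vector_Spaces.linear "\<lambda>(a :: 'a) f (i :: nat). a * f i" "(*)" g by (rule g(1))
  define e :: "nat \<Rightarrow> nat \<Rightarrow> 'a" where "e i = (\<lambda>j. if j = i then 1 else 0)" for i
  have "(\<Sum>i<n. b i * g (e i)) = \<phi> b" if b: "b \<in> B" for b
  proof -
    have "b = (\<Sum>i<n. (\<lambda>j. b i * e i j))"
    proof
      fix x
      have "(\<Sum>i<n. b i * e i x) = (\<Sum>i<n. if i = x then b i else 0)"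
        by (intro sum.cong) (auto simp: e_def)
      then show "b x = (\<Sum>i<n. (\<lambda>j. b i * e i j)) x"
        using supp[OF b, of x] by (cases "x < n") (simp_all add: sum_fun_apply)
    qed
    then have "g b = g (\<Sum>i<n. (\<lambda>j. b i * e i j))" by (rule arg_cong)
    also have "\<dots> = (\<Sum>i<n. g (\<lambda>j. b i * e i j))" by (rule g.sum)
    also have "\<dots> = (\<Sum>i<n. b i * g (e i))" by (intro sum.cong refl g.scale)
    finally have "g b = (\<Sum>i<n. b i * g (e i))" .
    with g(2)[OF b] show ?thesis by simp
  qed
  then show ?thesis by (intro exI[of _ "\<lambda>i. g (e i)"] ballI)
qed

text \<open>A functional equal to \<open>1\<close> on a basis taken from \<open>C\<close> works, because no element of \<open>C\<close>
  is a combination of two or more independent elements of \<open>C\<close>.\<close>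
lemma exists_nonvanishing_functional:
  fixes C :: "(nat \<Rightarrow> 'a::field) set"
  assumes supp: "\<And>c i. c \<in> C \<Longrightarrow> i \<ge> n \<Longrightarrow> c i = 0"
    and nz: "\<And>c. c \<in> C \<Longrightarrow> c \<noteq> (\<lambda>_. 0)"
    and no_comb: "\<And>S t c d. finite S \<Longrightarrow> S \<subseteq> C \<Longrightarrow> c \<in> C \<Longrightarrow> (\<And>b. b \<in> S \<Longrightarrow> t b \<noteq> 0) \<Longrightarrow>
       (\<And>i. c i = (\<Sum>b\<in>S. t b * b i)) \<Longrightarrow>
       (\<And>b b'. b \<in> S \<Longrightarrow> b' \<in> S \<Longrightarrow> (\<Sum>i<n. b i * d b' i) = (if b = b' then 1 else 0)) \<Longrightarrow>
       \<exists>b\<in>S. \<forall>b'\<in>S. b' = b"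
  shows "\<exists>lam. \<forall>c\<in>C. (\<Sum>i<n. c i * lam i) \<noteq> 0"
proof -
  interpret V: vector_space "\<lambda>(a :: 'a) f (i :: nat). a * f i" by (rule vector_space_fun)
  obtain B where B: "B \<subseteq> C" "V.independent B" "C \<subseteq> V.span B"
    using V.maximal_independent_subset by blast
  have suppB: "\<And>b i. b \<in> B \<Longrightarrow> i \<ge> n \<Longrightarrow> b i = 0" using supp B(1) by blast
  have dual: "\<exists>d. \<forall>b\<in>B. (\<Sum>i<n. b i * d i) = \<phi> b" for \<phi>
    by (rule independent_dual_vector[OF B(2)]) (rule suppB)
  obtain lam where lam: "\<And>b. b \<in> B \<Longrightarrow> (\<Sum>i<n. b i * lam i) = 1"
    using dual[of "\<lambda>_. 1"] by blast
  obtain d where d: "\<And>b b'. b \<in> B \<Longrightarrow> (\<Sum>i<n. b i * d b' i) = (if b = b' then 1 else 0)"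
  proof -
    have "\<forall>b'. \<exists>d. \<forall>b\<in>B. (\<Sum>i<n. b i * d i) = (if b = b' then 1 else 0)"
      by (intro allI dual)
    from choice[OF this] show ?thesis using that by blast
  qed
  have "(\<Sum>i<n. c i * lam i) \<noteq> 0" if c: "c \<in> C" for c
  proof -
    have "c \<in> V.span B" using c B(3) by (rule subsetD[rotated])
    then obtain T t where T: "finite T" "T \<subseteq> B" "c = (\<Sum>b\<in>T. (\<lambda>i. t b * b i))"
      unfolding V.span_explicit by (elim CollectE exE conjE) (rule that; assumption)
    define S where "S = {b \<in> T. t b \<noteq> 0}"
    have S: "finite S" "S \<subseteq> B" "\<And>b. b \<in> S \<Longrightarrow> t b \<noteq> 0" using T by (auto simp: S_def)
    have cS: "c i = (\<Sum>b\<in>S. t b * b i)" for i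
      unfolding T(3) sum_fun_apply S_def using T(1) by (intro sum.mono_neutral_right) auto
    have "S \<subseteq> C" using S(2) B(1) by blast
    then have "\<exists>b\<in>S. \<forall>b'\<in>S. b' = b"
    proof (rule no_comb[OF S(1) _ c S(3) cS])
      show "(\<Sum>i<n. b i * d b' i) = (if b = b' then 1 else 0)" if "b \<in> S" for b b'
        using that S(2) by (intro d) (rule subsetD)
    qed
    then obtain b where b: "b \<in> S" "\<forall>b'\<in>S. b' = b" by (elim bexE)
    have "S \<subseteq> {b}" by (rule subsetI, unfold singleton_iff, rule bspec[OF b(2)])
    with b(1) have "S = {b}" by (intro equalityI) simp_all
    then have "c i = t b * b i" for i using cS[of i] by simp
    then have "(\<Sum>i<n. c i * lam i) = t b * (\<Sum>i<n. b i * lam i)"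
      by (simp add: sum_distrib_left mult.assoc)
    moreover have "b \<in> B" "t b \<noteq> 0" using b(1) S(2,3) by auto
    ultimately show ?thesis using lam[of b] by simp
  qed
  then show ?thesis by (intro exI[of _ lam] ballI)
qed

lemma ins_poly_linform:
  "ins (\<lambda>c. [:c:]) x (linform n l) = (\<Sum>j<n. [:l j:] * x j)"
  by (simp only: linform_def ins_sum[OF const_poly_ident_hom] ins_mult[OF const_poly_ident_hom]
      ins_Const[OF const_poly_ident_hom] ins_Var[OF const_poly_ident_hom])

lemma linform_sum: "(\<Sum>i\<in>A. Const (c i) * linform n (l i)) = linform n (\<lambda>j. \<Sum>i\<in>A. c i * l i j)"
proof -
  have "(\<Sum>i\<in>A. Const (c i) * linform n (l i)) = (\<Sum>i\<in>A. \<Sum>j<n. Const (c i * l i j) * Var j)"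
    by (simp add: linform_def sum_distrib_left Const_mult mult.assoc)
  also have "\<dots> = linform n (\<lambda>j. \<Sum>i\<in>A. c i * l i j)"
    by (subst sum.swap) (simp add: linform_def Const_sum sum_distrib_right)
  finally show ?thesis .
qed

text \<open>The vectors \<open>c\<close> to be avoided are those whose combination has a nonzero
  cubic part that is the square of its linear part times a linear form. A dependency among them
  makes such cubic parts zero by \<open>squares_times_linear_forms_vanish\<close>.\<close>

lemma keller_exists_functional:
  fixes F :: "nat \<Rightarrow> 'a::field_char_0 mpoly" and l :: "nat \<Rightarrow> nat \<Rightarrow> 'a" and cub :: "nat \<Rightarrow> 'a mpoly"
  assumes keller: "keller n F"
    and F: "\<And>i. i < n \<Longrightarrow> F i = Const (k i) + linform n (l i) + cub i"
  shows "\<exists>lam. \<forall>c r. (\<forall>i\<ge>n. c i = 0) \<and>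
      (\<Sum>i<n. Const (c i) * cub i) = (\<Sum>i<n. Const (c i) * linform n (l i))\<^sup>2 * linform n r \<and>
      (\<Sum>i<n. Const (c i) * cub i) \<noteq> 0 \<longrightarrow> (\<Sum>i<n. c i * lam i) \<noteq> 0"
proof -
  let ?H = "\<lambda>c. \<Sum>i<n. Const (c i) * cub i"
  define Lc where "Lc c j = (\<Sum>i<n. c i * l i j)" for c j
  have Lc: "(\<Sum>i<n. Const (c i) * linform n (l i)) = linform n (Lc c)" for c
    unfolding linform_sum Lc_def ..
  \<comment> \<open>Support below \<open>n\<close> makes distinct functions distinct vectors, so
    that linear independence of functions is independence of coefficient vectors.\<close>
  define C where "C = {c. (\<forall>i\<ge>n. c i = 0) \<and> (\<exists>r. ?H c = linform n (Lc c) ^ 2 * linform n r) \<and> ?H c \<noteq> 0}"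
  have "\<exists>lam. \<forall>c\<in>C. (\<Sum>i<n. c i * lam i) \<noteq> 0"
  proof (rule exists_nonvanishing_functional)
    show "c i = 0" if "c \<in> C" "i \<ge> n" for c i using that by (auto simp: C_def)
    show "c \<noteq> (\<lambda>_. 0)" if "c \<in> C" for c using that by (auto simp: C_def)
  next
    fix S and t :: "(nat \<Rightarrow> 'a) \<Rightarrow> 'a" and c and d :: "(nat \<Rightarrow> 'a) \<Rightarrow> nat \<Rightarrow> 'a"
    assume S: "finite S" "S \<subseteq> C" and c: "c \<in> C" and t: "\<And>b. b \<in> S \<Longrightarrow> t b \<noteq> 0"
      and comb: "\<And>i. c i = (\<Sum>b\<in>S. t b * b i)"
      and d: "\<And>b b'. b \<in> S \<Longrightarrow> b' \<in> S \<Longrightarrow> (\<Sum>i<n. b i * d b' i) = (if b = b' then 1 else 0)"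
    show "\<exists>b\<in>S. \<forall>b'\<in>S. b' = b"
    proof (rule ccontr)
      assume *: "\<not> (\<exists>b\<in>S. \<forall>b'\<in>S. b' = b)"
      have "S \<noteq> {}"
      proof
        assume "S = {}"
        then have "c = (\<lambda>_. 0)" using comb by auto
        then show False using c by (auto simp: C_def)
      qed
      then obtain i where i: "i \<in> S" by blast
      obtain r where r: "\<And>s. s \<in> C \<Longrightarrow> ?H s = linform n (Lc s) ^ 2 * linform n (r s)"
      proof -
        have "\<forall>s\<in>C. \<exists>r. ?H s = linform n (Lc s) ^ 2 * linform n r" by (simp add: C_def)
        then show ?thesis using that by metis
      qed
      obtain N where N: "\<And>i k. i < n \<Longrightarrow> k < n \<Longrightarrow>
          (\<Sum>j<n. pdiff j (F i) * N j k) = (if i = k then 1 else 0)"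
        using keller_right_inverse[OF keller] by blast
      define ev :: "(nat \<Rightarrow> 'a poly) \<Rightarrow> 'a mpoly \<Rightarrow> 'a poly" where "ev x = ins (\<lambda>c. [:c:]) x" for x
      have ev_hom: "comm_ring_hom (ev x)" for x
        unfolding ev_def by (rule ins_hom[OF const_poly_ident_hom])
      define lf :: "(nat \<Rightarrow> 'a) \<Rightarrow> (nat \<Rightarrow> 'a poly) \<Rightarrow> 'a poly" where "lf l x = (\<Sum>j<n. [:l j:] * x j)" for l x
      have ev_lf: "ev x (linform n l) = lf l x" for x l
        by (simp only: ev_def lf_def ins_poly_linform)
      have ev_C: "ev x (Const a) = [:a:]" for x a
        by (simp only: ev_def ins_Const[OF const_poly_ident_hom])
      have lf_add: "lf l (\<lambda>i. x i + y i) = lf l x + lf l y" for l x y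
        by (simp only: lf_def distrib_left sum.distrib)
      have lf_smult: "lf l (\<lambda>i. a * x i) = a * lf l x" for l a x
        by (simp only: lf_def sum_distrib_left mult.left_commute)
      have dep: "(\<Sum>s\<in>S. [:t s:] * (lf (Lc s) x ^ 2 * lf (r s) x)) = (\<Sum>s\<in>S. [:t s:] * lf (Lc s) x) ^ 2 * lf (r c) x" for x
      proof -
        interpret ev: comm_ring_hom "ev x" by (rule ev_hom)
        have swap: "(\<Sum>s\<in>S. Const (t s) * (\<Sum>i<n. Const (s i) * p i)) = (\<Sum>i<n. Const (c i) * p i)"
          for p :: "nat \<Rightarrow> 'a mpoly"
        proof -
          have "(\<Sum>s\<in>S. Const (t s) * (\<Sum>i<n. Const (s i) * p i)) = (\<Sum>i<n. \<Sum>s\<in>S. Const (t s * s i) * p i)"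
            by (subst sum.swap) (simp add: sum_distrib_left Const_mult mult.assoc)
          then show ?thesis by (simp add: comb Const_sum sum_distrib_right)
        qed
        have "(\<Sum>s\<in>S. Const (t s) * ?H s) = (\<Sum>s\<in>S. Const (t s) * linform n (Lc s)) ^ 2 * linform n (r c)"
          unfolding swap Lc[symmetric] using r[OF c] by (simp add: Lc)
        moreover have "(\<Sum>s\<in>S. Const (t s) * ?H s) = (\<Sum>s\<in>S. Const (t s) * (linform n (Lc s) ^ 2 * linform n (r s)))"
          using r S(2) by (intro sum.cong refl) auto
        ultimately have "ev x (\<Sum>s\<in>S. Const (t s) * (linform n (Lc s) ^ 2 * linform n (r s)))
            = ev x ((\<Sum>s\<in>S. Const (t s) * linform n (Lc s)) ^ 2 * linform n (r c))"
          by simp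
        then show ?thesis
          by (simp only: ev.hom_sum ev.hom_mult ev.hom_power ev_lf ev_C)
      qed
      \<comment> \<open>The inverse Jacobian matrix at \<open>x\<close> applied to the dual vector
        \<open>d q\<close>: in this direction the combination with coefficients \<open>s\<close> has
        derivative \<open>1\<close> for \<open>s = q\<close> and \<open>0\<close> for the other
        members of \<open>S\<close>.\<close>
      define y where "y x q j = (\<Sum>k<n. ev x (N j k) * [:d q k:])" for x q j
      have y: "(1 + 2 * lf (Lc s) x * lf (r s) x) * lf (Lc s) (y x q) + lf (Lc s) x ^ 2 * lf (r s) (y x q)
          = (if s = q then 1 else 0)" if s: "s \<in> S" and q: "q \<in> S" for s q x
      proof -
        interpret ev: comm_ring_hom "ev x" by (rule ev_hom)
        let ?f = "Const 0 + (\<Sum>i<n. Const (s i) * F i)"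
        let ?A = "linform n (Lc s)" and ?R = "linform n (r s)"
        have "?f = (\<Sum>i<n. Const (s i) * Const (k i) + Const (s i) * linform n (l i) + Const (s i) * cub i)"
          by (simp add: F distrib_left)
        also have "\<dots> = Const (\<Sum>i<n. s i * k i) + ?A + ?H s"
          by (simp add: sum.distrib Lc Const_sum Const_mult)
        also have "?H s = ?A ^ 2 * ?R" using r s S(2) by blast
        finally have f: "?f = Const (\<Sum>i<n. s i * k i) + ?A + ?A ^ 2 * ?R" .
        have pf: "pdiff j ?f = (1 + 2 * ?A * ?R) * Const (Lc s j) + ?A ^ 2 * Const (r s j)" if "j < n" for j
          unfolding f using that by (simp add: pdiff_linform pdiff_power algebra_simps)
        have "(\<Sum>j<n. ev x (pdiff j ?f) * ev x (N j k)) = [:s k:]" if "k < n" for k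
        proof -
          have "ev x (\<Sum>j<n. pdiff j ?f * N j k) = ev x (Const (s k))"
            by (rule arg_cong[OF lincomb_right_inverse[OF N that]])
          then show ?thesis by (simp only: ev.hom_sum ev.hom_mult ev_C)
        qed
        then have "(\<Sum>k<n. (\<Sum>j<n. ev x (pdiff j ?f) * ev x (N j k)) * [:d q k:]) = (\<Sum>k<n. [:s k:] * [:d q k:])"
          by (intro sum.cong refl) simp
        also have "(\<Sum>k<n. [:s k:] * [:d q k:]) = [:\<Sum>k<n. s k * d q k:]"
          by (induction n) simp_all
        also have "\<dots> = (if s = q then 1 else 0)" using d[OF s q] by (simp add: one_pCons)
        also have "(\<Sum>k<n. (\<Sum>j<n. ev x (pdiff j ?f) * ev x (N j k)) * [:d q k:])
            = (\<Sum>j<n. ev x (pdiff j ?f) * y x q j)"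
          unfolding y_def sum_distrib_left sum_distrib_right mult.assoc by (rule sum.swap)
        also have "\<dots> = (\<Sum>j<n. ((1 + 2 * lf (Lc s) x * lf (r s) x) * [:Lc s j:] + lf (Lc s) x ^ 2 * [:r s j:]) * y x q j)"
        proof (intro sum.cong refl)
          fix j assume "j \<in> {..<n}"
          then have "ev x (pdiff j ?f) = (1 + 2 * lf (Lc s) x * lf (r s) x) * [:Lc s j:] + lf (Lc s) x ^ 2 * [:r s j:]"
            using pf[of j] by (simp only: lessThan_iff ev.hom_add ev.hom_mult ev.hom_power ev.hom_one ev_lf ev_C mult_2)
          then show "ev x (pdiff j ?f) * y x q j = ((1 + 2 * lf (Lc s) x * lf (r s) x) * [:Lc s j:] + lf (Lc s) x ^ 2 * [:r s j:]) * y x q j"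
            by simp
        qed
        also have "\<dots> = (1 + 2 * lf (Lc s) x * lf (r s) x) * lf (Lc s) (y x q) + lf (Lc s) x ^ 2 * lf (r s) (y x q)"
          unfolding lf_def[of _ "y x q"] distrib_right mult.assoc sum.distrib sum_distrib_left ..
        finally show ?thesis .
      qed
      have lf_0: "lf l (\<lambda>_. 0) = 0" for l by (simp add: lf_def)
      \<comment> \<open>At the origin only the linear parts contribute to the derivatives, so these
        directions are dual to the forms \<open>lf (Lc s)\<close>, and their coordinates are
        constants.\<close>
      define w where "w = y (\<lambda>_. 0)"
      have w_const: "w q j = [:\<Sum>k<n. ins (\<lambda>a. a) (\<lambda>_. 0) (N j k) * d q k:]" for q j
      proof -
        have "ev (\<lambda>_. 0) p = [:ins (\<lambda>a. a) (\<lambda>_. 0) p:]" for p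
          by (simp add: ev_def hom_ins[OF const_poly_ident_hom])
        then have "w q j = (\<Sum>k<n. [:ins (\<lambda>a. a) (\<lambda>_. 0) (N j k) * d q k:])"
          by (simp add: w_def y_def mult.commute)
        also have "\<dots> = [:\<Sum>k<n. ins (\<lambda>a. a) (\<lambda>_. 0) (N j k) * d q k:]"
          by (induction n) simp_all
        finally show ?thesis .
      qed
      have w: "lf (Lc s) (w q) = (if s = q then 1 else 0)" if "s \<in> S" "q \<in> S" for s q
        using y[OF that, of "\<lambda>_. 0"] by (simp add: lf_0 w_def zero_power)
      have wr: "lf (r s) (w q) = [:\<Sum>j<n. r s j * (\<Sum>k<n. ins (\<lambda>a. a) (\<lambda>_. 0) (N j k) * d q k):]" for s q
      proof -
        have "(\<Sum>j<m. [:r s j * (\<Sum>k<n. ins (\<lambda>a. a) (\<lambda>_. 0) (N j k) * d q k):])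
            = [:\<Sum>j<m. r s j * (\<Sum>k<n. ins (\<lambda>a. a) (\<lambda>_. 0) (N j k) * d q k):]" for m
          by (induction m) simp_all
        then show ?thesis by (simp add: lf_def w_const mult.commute)
      qed
      have "lf (r i) x = 0" for x
      proof (rule squares_times_linear_forms_vanish[where S = S and t = t and L = "\<lambda>s. lf (Lc s)"
            and \<rho> = "\<lambda>s. lf (r s)" and \<sigma> = "lf (r c)" and w = w
            and r = "\<lambda>s q. \<Sum>j<n. r s j * (\<Sum>k<n. ins (\<lambda>a. a) (\<lambda>_. 0) (N j k) * d q k)"])
        show "\<exists>y. \<forall>s\<in>S. (1 + 2 * lf (Lc s) x * lf (r s) x) * lf (Lc s) y + (lf (Lc s) x)\<^sup>2 * lf (r s) y
            = (if s = q then 1 else 0)" if "q \<in> S" for x q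
          using y that by blast
        show "\<exists>j\<in>S. j \<noteq> i" if "i \<in> S" for i using * that by blast
      qed (fact S(1) t lf_add lf_smult dep w i | rule wr)+
      moreover have "lf (r i) (\<lambda>k. if k = j then 1 else 0) = [:r i j:]" if "j < n" for j
        using that by (simp add: lf_def if_distrib[of "\<lambda>x. _ * x"] cong: if_cong)
      ultimately have "r i j = 0" if "j < n" for j
        using that by simp
      then have "linform n (r i) = 0" by (simp add: linform_def)
      with r[of i] i S(2) show False by (auto simp: C_def)
    qed
  qed
  then show ?thesis by (auto simp: C_def Lc)
qed

subsection \<open>Linear combinations of the stabilized components\<close>

lemma graded_cubic_no_quad:
  assumes "\<forall>m\<in>Poly_Mapping.keys p. mdeg m \<le> 3 \<and> mdeg m \<noteq> 2"
  shows "graded p = [:Const (Poly_Mapping.lookup p 0), coeff (graded p) 1, 0, coeff (graded p) 3:]"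
proof (rule poly_eqI)
  fix k
  have empty: "{m. m \<in> Poly_Mapping.keys p \<and> mdeg m = k} = {}" if "k = 2 \<or> k > 3"
    using assms that by fastforce
  have "coeff (graded p) k = 0" if "k = 2 \<or> k > 3"
    unfolding coeff_graded empty[OF that] by simp
  moreover have "k = 0 \<or> k = 1 \<or> k = 3 \<or> k = 2 \<or> k > 3" by arith
  ultimately show "coeff (graded p) k = coeff [:Const (Poly_Mapping.lookup p 0), coeff (graded p) 1, 0, coeff (graded p) 3:] k"
    using coeff_0_graded[of p]
    by (auto simp: coeff_pCons numeral_2_eq_2 numeral_3_eq_3 split: nat.splits)
qed

text \<open>These are exactly the combinations for map (a), with \<open>b\<close> the coefficient of
  \<open>Var n\<close>; those for (b) and (c) will be reduced to them.\<close>

lemma keller_cubic_exists_lam: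
  fixes F :: "nat \<Rightarrow> 'a::field_char_0 mpoly"
  assumes keller: "keller n F" and cubic: "cubic_no_quad n F"
  obtains lam where "\<And>c0 c b. reducible (Const c0 + (\<Sum>i<n. Const (c i) * (F i - Const (lam i) * Var n ^ 3)) + Const b * Var n) \<Longrightarrow>
     \<exists>a. Const c0 + (\<Sum>i<n. Const (c i) * (F i - Const (lam i) * Var n ^ 3)) + Const b * Var n = Const a"
proof -
  have vF: "vars (F i) \<subseteq> {..<n}" if "i < n" for i
    using keller that by (auto simp: keller_def poly_map_def)
  define k where "k i = Poly_Mapping.lookup (F i) 0" for i
  define cub where "cub i = coeff (graded (F i)) 3" for i
  obtain l where l: "\<And>i. i < n \<Longrightarrow> coeff (graded (F i)) 1 = linform n (l i)"
  proof -
    have "\<forall>i. \<exists>l. i < n \<longrightarrow> coeff (graded (F i)) 1 = linform n l"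
      using coeff_1_graded[OF vF] by metis
    from choice[OF this] show ?thesis using that by blast
  qed
  have gF: "graded (F i) = [:Const (k i), linform n (l i), 0, cub i:]" if "i < n" for i
    using graded_cubic_no_quad[of "F i"] cubic that l[OF that]
    by (simp add: cubic_no_quad_def k_def cub_def)
  have F: "F i = Const (k i) + linform n (l i) + cub i" if "i < n" for i
    using poly_graded_1[of "F i"] gF[OF that] by (simp add: algebra_simps)
  obtain lam where lam: "\<And>c r. \<lbrakk>\<forall>i\<ge>n. c i = 0;
      (\<Sum>i<n. Const (c i) * cub i) = (\<Sum>i<n. Const (c i) * linform n (l i))\<^sup>2 * linform n r;
      (\<Sum>i<n. Const (c i) * cub i) \<noteq> 0\<rbrakk> \<Longrightarrow> (\<Sum>i<n. c i * lam i) \<noteq> 0"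
    using keller_exists_functional[OF keller F] by blast
  show ?thesis
  proof
    fix c0 c b
    let ?g = "Const c0 + (\<Sum>i<n. Const (c i) * (F i - Const (lam i) * Var n ^ 3)) + Const b * Var n"
    define f where "f = Const c0 + (\<Sum>i<n. Const (c i) * F i)"
    define a where "a = (\<Sum>i<n. c i * lam i)"
    assume red: "reducible ?g"
    have g: "?g = f - Const a * Var n ^ 3 + Const b * Var n"
    proof -
      have "(\<Sum>i<n. Const (c i) * (F i - Const (lam i) * Var n ^ 3))
          = (\<Sum>i<n. Const (c i) * F i) - (\<Sum>i<n. Const (c i * lam i) * Var n ^ 3)"
        by (simp only: right_diff_distrib sum_subtractf Const_mult mult.assoc)
      also have "(\<Sum>i<n. Const (c i * lam i) * Var n ^ 3) = Const a * Var n ^ 3"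
        by (simp only: a_def Const_sum sum_distrib_right)
      finally show ?thesis by (simp add: f_def)
    qed
    have vf: "vars f \<subseteq> {..<n}"
    proof -
      have "vars (Const (c i) * F i) \<subseteq> {..<n}" if "i < n" for i
        using vars_mult[of "Const (c i)" "F i"] vF[OF that] by simp
      then have "vars (\<Sum>i<n. Const (c i) * F i) \<subseteq> {..<n}"
        by (intro order_trans[OF vars_sum] UN_least) auto
      then show ?thesis unfolding f_def by (intro order_trans[OF vars_add]) simp
    qed
    then have nvf: "n \<notin> vars f" by auto
    show "\<exists>a. ?g = Const a"
    proof (cases "\<forall>i<n. c i = 0")
      case True
      then have "?g = Const b * Var n + Const c0" by simp
      with red not_reducible_linear_in_var[of b n "Const c0"] have "b = 0" by auto
      with True show ?thesis by auto
    next
      case False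
      then obtain i where "i < n" "c i \<noteq> 0" by blast
      then have uni: "unimodular_grad n f"
        unfolding f_def by (rule keller_unimodular_grad[OF keller])
      \<comment> \<open>A nonzero \<open>a\<close> is excluded for every \<open>b\<close> by the
        unimodular gradient. Once \<open>a = 0\<close>, a nonzero \<open>b\<close> would leave a
        polynomial linear in \<open>Var n\<close>.\<close>
      have "a = 0"
        using not_reducible_cubic_in_var[OF _ nvf uni, of a b] red unfolding g by blast
      moreover from this have "b = 0"
        using not_reducible_linear_in_var[OF _ nvf, of b] red unfolding g by (auto simp: add.commute)
      ultimately have red: "reducible f" using red unfolding g by simp
      interpret graded: comm_ring_hom "graded :: 'a mpoly \<Rightarrow> _" by (rule graded_hom)
      have gsum: "graded f = [:Const c0:] + (\<Sum>i<n. [:Const (c i):] * [:Const (k i), linform n (l i), 0, cub i:])"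
        unfolding f_def graded.hom_add graded.hom_sum graded.hom_mult graded_Const
        by (intro arg_cong2[of _ _ _ _ "(+)"] arg_cong2[of _ _ _ _ "(*)"] sum.cong refl gF) simp
      have c1: "coeff (graded f) 1 = (\<Sum>i<n. Const (c i) * linform n (l i))"
        and c2: "coeff (graded f) 2 = 0"
        and c3: "coeff (graded f) 3 = (\<Sum>i<n. Const (c i) * cub i)"
        unfolding gsum coeff_add coeff_sum by (simp_all add: numeral_2_eq_2 numeral_3_eq_3 mult.commute)
      have d3: "degree (graded f) \<le> 3"
        unfolding gsum by (intro degree_add_le degree_sum_le) auto
      obtain l' r where lr: "f = linform n l' + linform n l' ^ 2 * linform n r" "linform n l' ^ 2 * linform n r \<noteq> 0"
        by (rule reducible_cubic_form[OF uni vf d3 c2 red])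
      have gf: "graded f = [:0, linform n l', 0, linform n l' ^ 2 * linform n r:]"
        unfolding lr(1) graded.hom_add graded.hom_mult graded.hom_power graded_linform
        by (simp add: power2_eq_square mult.assoc)
      then have "coeff (graded f) 1 = linform n l'" "coeff (graded f) 3 = linform n l' ^ 2 * linform n r"
        by (simp_all add: numeral_3_eq_3)
      with c1 c3 have e: "(\<Sum>i<n. Const (c i) * linform n (l i)) = linform n l'"
        "(\<Sum>i<n. Const (c i) * cub i) = linform n l' ^ 2 * linform n r" by simp_all
      \<comment> \<open>\<open>c\<close> is arbitrary from index \<open>n\<close> on, whereas
        \<open>lam\<close> was obtained for vectors vanishing there.\<close>
      let ?c = "\<lambda>i. if i < n then c i else 0"
      have restr: "(\<Sum>i<n. Const (?c i) * p i) = (\<Sum>i<n. Const (c i) * p i)" for p :: "nat \<Rightarrow> 'a mpoly"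
        by (intro sum.cong) auto
      have "(\<Sum>i<n. ?c i * lam i) \<noteq> 0"
        by (rule lam[of ?c r]) (use lr(2) in \<open>simp_all only: restr e, simp_all\<close>)
      moreover have "(\<Sum>i<n. ?c i * lam i) = a" unfolding a_def by (intro sum.cong) auto
      ultimately have "a \<noteq> 0" by metis
      with \<open>a = 0\<close> show ?thesis by simp
    qed
  qed
qed

lemma sum_lessThan_add2: "(\<Sum>i<n + 2. f i) = (\<Sum>i<n. f i) + f n + f (n + 1 :: nat)"
  for f :: "nat \<Rightarrow> 'b::comm_monoid_add"
  by (simp add: numeral_2_eq_2)

lemma less_add_2_cases: "i < n + 2 \<Longrightarrow> i < n \<or> i = n \<or> i = n + 1" for i n :: nat
  by linarith

subsection \<open>Jacobian determinants\<close>

lemma det_last_row_unit: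
  fixes A :: "'a::idom mat"
  assumes A: "A \<in> carrier_mat (m + 1) (m + 1)"
    and "\<And>j. j < m \<Longrightarrow> A $$ (m, j) = 0" and "A $$ (m, m) = 1"
  shows "det A = det (mat m m (\<lambda>(i, j). A $$ (i, j)))"
proof -
  have "A = four_block_mat (mat m m (\<lambda>(i, j). A $$ (i, j))) (mat m 1 (\<lambda>(i, j). A $$ (i, m))) (0\<^sub>m 1 m) (1\<^sub>m 1)"
    by (rule eq_matI) (use assms in \<open>auto simp: less_Suc_eq\<close>)
  then have "det A = det (four_block_mat (mat m m (\<lambda>(i, j). A $$ (i, j))) (mat m 1 (\<lambda>(i, j). A $$ (i, m))) (0\<^sub>m 1 m) (1\<^sub>m 1))"
    by (rule arg_cong)
  also have "\<dots> = det (mat m m (\<lambda>(i, j). A $$ (i, j))) * det (1\<^sub>m 1 :: 'a mat)"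
    by (rule det_four_block_mat_lower_left_zero) auto
  finally show ?thesis by simp
qed

lemma det_last_col_unit:
  fixes A :: "'a::idom mat"
  assumes A: "A \<in> carrier_mat (m + 1) (m + 1)"
    and "\<And>i. i < m \<Longrightarrow> A $$ (i, m) = 0" and "A $$ (m, m) = 1"
  shows "det A = det (mat m m (\<lambda>(i, j). A $$ (i, j)))"
proof -
  have "A = four_block_mat (mat m m (\<lambda>(i, j). A $$ (i, j))) (0\<^sub>m m 1) (mat 1 m (\<lambda>(i, j). A $$ (m, j))) (1\<^sub>m 1)"
    by (rule eq_matI) (use assms in \<open>auto simp: less_Suc_eq\<close>)
  then have "det A = det (four_block_mat (mat m m (\<lambda>(i, j). A $$ (i, j))) (0\<^sub>m m 1) (mat 1 m (\<lambda>(i, j). A $$ (m, j))) (1\<^sub>m 1))"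
    by (rule arg_cong)
  also have "\<dots> = det (mat m m (\<lambda>(i, j). A $$ (i, j))) * det (1\<^sub>m 1 :: 'a mat)"
    by (rule det_four_block_mat_upper_right_zero) auto
  finally show ?thesis by simp
qed

lemma keller_pdiff_eq_0:
  assumes "keller n F" "i < n" "j \<ge> n"
  shows "pdiff j (F i) = 0"
proof -
  have "vars (F i) \<subseteq> {..<n}" using assms(1,2) by (simp add: keller_def poly_map_def)
  with assms(3) show ?thesis by (intro pdiff_notin_vars) auto
qed

text \<open>The last row is a unit vector, and expanding along it deletes the last column, the only
  one where the cubes of \<open>Var n\<close> contribute.\<close>

lemma det_jac_a:
  fixes F :: "nat \<Rightarrow> 'a::field_char_0 mpoly"
  assumes F: "keller n F"
    and G: "\<And>i. i < n \<Longrightarrow> G i = F i - Const (lam i) * Var n ^ 3" "G n = Var n"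
  shows "det (jac (n + 1) G) = det (jac n F)"
proof -
  have "det (jac (n + 1) G) = det (mat n n (\<lambda>(i, j). jac (n + 1) G $$ (i, j)))"
    by (rule det_last_row_unit) (auto simp: jac_def G)
  also have "mat n n (\<lambda>(i, j). jac (n + 1) G $$ (i, j)) = jac n F"
    by (rule eq_matI) (auto simp: jac_def G pdiff_power)
  finally show ?thesis .
qed

text \<open>\<open>Var (n + 1)\<close> occurs in the last component only, with coefficient
  \<open>1\<close>, so the last column is a unit vector and its removal leaves map (a).\<close>

lemma det_jac_b:
  fixes F :: "nat \<Rightarrow> 'a::field_char_0 mpoly"
  assumes F: "keller n F"
    and G: "\<And>i. i < n \<Longrightarrow> G i = F i - Const (lam i) * Var n ^ 3" "G n = Var n"
      "G (n + 1) = Var (n + 1) + Var n ^ 3"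
  shows "det (jac (n + 2) G) = det (jac n F)"
proof -
  have "det (jac (n + 1 + 1) G) = det (mat (n + 1) (n + 1) (\<lambda>(i, j). jac (n + 1 + 1) G $$ (i, j)))"
  proof (rule det_last_col_unit)
    show "jac (n + 1 + 1) G $$ (i, n + 1) = 0" if "i < n + 1" for i
      using that G keller_pdiff_eq_0[OF F, of i "n + 1"]
      by (cases "i = n") (auto simp: jac_def pdiff_power)
    show "jac (n + 1 + 1) G $$ (n + 1, n + 1) = 1"
      using G(3) by (simp add: jac_def pdiff_power)
  qed (simp add: jac_def)
  also have "mat (n + 1) (n + 1) (\<lambda>(i, j). jac (n + 1 + 1) G $$ (i, j)) = jac (n + 1) G"
    by (rule eq_matI) (auto simp: jac_def)
  also have "det \<dots> = det (jac n F)" by (rule det_jac_a[OF F G(1,2)])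
  finally show ?thesis by simp
qed

text \<open>Exchanging the last two rows moves the only nonzero entry of the last column into the
  corner. The remaining minor is that of map (a), and the exchange accounts for the sign.\<close>

lemma det_jac_c:
  fixes F :: "nat \<Rightarrow> 'a::field_char_0 mpoly"
  assumes F: "keller n F"
    and G: "\<And>i. i < n \<Longrightarrow> G i = F i - Const (lam i) * Var n ^ 3"
      "G n = Var (n + 1) - Const 3 * linform n lam * Var n ^ 2" "G (n + 1) = Var n"
  shows "det (jac (n + 2) G) = - det (jac n F)"
proof -
  let ?S = "swaprows n (n + 1) (jac (n + 2) G)"
  have S: "?S \<in> carrier_mat (n + 1 + 1) (n + 1 + 1)" by (simp add: jac_def mat_swaprows_def)
  have J: "jac (n + 2) G \<in> carrier_mat (n + 2) (n + 2)" by (simp add: jac_def)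
  have Sij: "?S $$ (i, j) = pdiff j (if i = n then Var n else if i = n + 1 then G n else F i - Const (lam i) * Var n ^ 3)"
    if "i < n + 2" "j < n + 2" for i j
    using that G by (auto simp: mat_swaprows_def jac_def)
  have "det ?S = - det (jac (n + 2) G)"
    by (rule det_swaprows[OF _ _ _ J]) auto
  moreover have "det ?S = det (mat (n + 1) (n + 1) (\<lambda>(i, j). ?S $$ (i, j)))"
  proof (rule det_last_col_unit[OF S])
    show "?S $$ (i, n + 1) = 0" if "i < n + 1" for i
      using that keller_pdiff_eq_0[OF F, of i "n + 1"] by (subst Sij) (auto simp: pdiff_power)
    show "?S $$ (n + 1, n + 1) = 1"
      by (subst Sij) (auto simp: G(2) pdiff_power pdiff_linform)
  qed
  moreover have "mat (n + 1) (n + 1) (\<lambda>(i, j). ?S $$ (i, j))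
      = jac (n + 1) (\<lambda>i. if i = n then Var n else F i - Const (lam i) * Var n ^ 3)"
    (is "?M = ?J")
  proof (rule eq_matI)
    fix i j assume "i < dim_row ?J" "j < dim_col ?J"
    then have ij: "i < n + 1" "j < n + 1" by (simp_all add: jac_def)
    then have "?M $$ (i, j) = ?S $$ (i, j)" by simp
    also have "\<dots> = pdiff j (if i = n then Var n else if i = n + 1 then G n else F i - Const (lam i) * Var n ^ 3)"
      using ij by (intro Sij) auto
    also have "\<dots> = ?J $$ (i, j)" using ij by (simp add: jac_def del: pdiff_simps)
    finally show "?M $$ (i, j) = ?J $$ (i, j)" .
  qed (simp_all add: jac_def)
  moreover have "det (jac (n + 1) (\<lambda>i. if i = n then Var n else F i - Const (lam i) * Var n ^ 3)) = det (jac n F)"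
    by (rule det_jac_a[OF F, where lam = lam]) auto
  ultimately have "- det (jac (n + 2) G) = det (jac n F)" by simp
  then show ?thesis by (simp only: equation_minus_iff)
qed

subsection \<open>Degrees of the stabilized maps\<close>

definition homog :: "nat \<Rightarrow> 'a::comm_ring_1 mpoly \<Rightarrow> bool" where
  "homog d p \<longleftrightarrow> (\<forall>m\<in>Poly_Mapping.keys p. mdeg m = d)"

lemma homog_Var: "homog 1 (Var i)"
  by (simp add: homog_def Var_def)

lemma homog_Const: "homog 0 (Const c)"
  by (simp add: homog_def Const_def mdeg_def)

lemma homog_mult:
  assumes "homog d p" "homog e q"
  shows "homog (d + e) (p * q)"
  unfolding homog_def
proof
  fix m assume "m \<in> Poly_Mapping.keys (p * q)"
  then obtain a b where "m = a + b" "a \<in> Poly_Mapping.keys p" "b \<in> Poly_Mapping.keys q"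
    using keys_mult[of p q] by blast
  then show "mdeg m = d + e" using assms by (simp add: homog_def mdeg_add)
qed

lemma homog_power: "homog 1 p \<Longrightarrow> homog k (p ^ k)"
proof (induction k)
  case 0
  show ?case using homog_Const[of 1] by simp
next
  case (Suc k)
  then show ?case using homog_mult[of 1 p k "p ^ k"] by simp
qed

lemma homog_sum: "(\<And>i. i \<in> A \<Longrightarrow> homog d (f i)) \<Longrightarrow> homog d (sum f A)"
proof (induction A rule: infinite_finite_induct)
  case (insert x A)
  then show ?case using keys_add[of "f x" "sum f A"] by (auto simp: homog_def)
qed (simp_all add: homog_def)

lemma homog_smult_Var_power: "homog k (Const c * Var i ^ k)"
  using homog_mult[OF homog_Const homog_power[OF homog_Var]] by simp

lemma homog_linform: "homog 1 (linform n l)"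
  unfolding linform_def by (rule homog_sum) (metis homog_smult_Var_power power_one_right)

definition cubic_linear :: "'a::comm_ring_1 mpoly \<Rightarrow> bool" where
  "cubic_linear p \<longleftrightarrow> (\<forall>m\<in>Poly_Mapping.keys p. mdeg m \<le> 3 \<and> mdeg m \<noteq> 2)"

lemma cubic_linear_homog: "homog d p \<Longrightarrow> d \<le> 3 \<Longrightarrow> d \<noteq> 2 \<Longrightarrow> cubic_linear p"
  by (auto simp: homog_def cubic_linear_def)

lemma cubic_linear_add: "cubic_linear p \<Longrightarrow> cubic_linear q \<Longrightarrow> cubic_linear (p + q)"
  using keys_add[of p q] by (auto simp: cubic_linear_def)

lemma cubic_linear_diff: "cubic_linear p \<Longrightarrow> cubic_linear q \<Longrightarrow> cubic_linear (p - q)"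
  using cubic_linear_add[of p "- q"] by (simp add: cubic_linear_def keys_def)

lemma cubic_linear_Var: "cubic_linear (Var i)"
  by (rule cubic_linear_homog[OF homog_Var]) auto

lemma cubic_linear_smult_cube: "cubic_linear (Const c * Var i ^ 3)"
  by (rule cubic_linear_homog[OF homog_smult_Var_power]) auto

lemma cubic_linear_cube: "cubic_linear (Var i ^ 3)"
  using cubic_linear_smult_cube[of 1 i] by simp

lemma cubic_linear_linform_square: "cubic_linear (Const c * linform n l * Var i ^ 2)"
  by (rule cubic_linear_homog[OF homog_mult[OF homog_mult[OF homog_Const homog_linform] homog_power[OF homog_Var]]]) auto

subsection \<open>Variables of the stabilized maps\<close>

lemma vars_subset_intros:
  "vars p \<subseteq> A \<Longrightarrow> vars q \<subseteq> A \<Longrightarrow> vars (p + q) \<subseteq> A"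
  "vars p \<subseteq> A \<Longrightarrow> vars q \<subseteq> A \<Longrightarrow> vars (p - q) \<subseteq> A"
  "vars p \<subseteq> A \<Longrightarrow> vars q \<subseteq> A \<Longrightarrow> vars (p * q) \<subseteq> A"
  "vars p \<subseteq> A \<Longrightarrow> vars (p ^ k) \<subseteq> A"
  "(\<And>i. i \<in> B \<Longrightarrow> vars (f i) \<subseteq> A) \<Longrightarrow> vars (sum f B) \<subseteq> A"
  "(\<And>i. i \<in> vars p \<Longrightarrow> vars (g i) \<subseteq> A) \<Longrightarrow> vars (subst p g) \<subseteq> A"
  using vars_add[of p q] vars_diff[of p q] vars_mult[of p q] vars_power[of p k] vars_sum[of f B]
    vars_subst[of p g] by blast+

lemma vars_linform: "vars (linform n l) \<subseteq> {..<n}"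
  unfolding linform_def by (intro vars_subset_intros) auto

subsection \<open>Invertibility\<close>

text \<open>The inverse first recovers \<open>Var n\<close> as \<open>W n\<close>, then adds back
  \<open>lam j\<close> times its cube and applies \<open>H\<close>. Assumption \<open>WG\<close> may
  use that the first \<open>n\<close> variables are already recovered, since in (c) a further
  component depends on them.\<close>

lemma invertible_extend:
  fixes F :: "nat \<Rightarrow> 'a::comm_ring_1 mpoly"
  assumes F: "poly_map n F" and H: "poly_map n H"
    and FH: "\<And>i. i < n \<Longrightarrow> subst (F i) H = Var i" and HF: "\<And>i. i < n \<Longrightarrow> subst (H i) F = Var i"
    and nm: "n < m" and G: "\<And>i. i < n \<Longrightarrow> G i = F i - Const (lam i) * Var n ^ 3"
    and Wn: "subst (W n) G = Var n"
    and H': "\<And>i. i < n \<Longrightarrow> H' i = subst (H i) (\<lambda>j. Var j + Const (lam j) * W n ^ 3)"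
      "\<And>i. n \<le> i \<Longrightarrow> H' i = W i"
    and W: "\<And>i. n \<le> i \<Longrightarrow> i < m \<Longrightarrow> vars (W i) \<subseteq> {..<m}"
    and GW: "\<And>i. n \<le> i \<Longrightarrow> i < m \<Longrightarrow> subst (G i) H' = Var i"
    and WG: "\<And>i. n \<le> i \<Longrightarrow> i < m \<Longrightarrow> (\<And>j. j < n \<Longrightarrow> subst (H' j) G = Var j) \<Longrightarrow> subst (W i) G = Var i"
  shows "invertible_pm m G"
  unfolding invertible_pm_def
proof (intro exI[of _ H'] conjI allI impI)
  let ?S = "\<lambda>j. Var j + Const (lam j) * W n ^ 3"
  have vF: "\<And>i j. i < n \<Longrightarrow> j \<in> vars (F i) \<Longrightarrow> j < n" and vH: "\<And>i j. i < n \<Longrightarrow> j \<in> vars (H i) \<Longrightarrow> j < n"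
    using F H by (auto simp: poly_map_def)
  have vH': "vars (H' i) \<subseteq> {..<m}" if "i < m" for i
  proof (cases "i < n")
    case True
    have "k < m" if "k \<in> vars (H i)" for k using vH[OF True that] nm by simp
    then show ?thesis
      unfolding H'(1)[OF True] using nm W[of n] by (intro vars_subset_intros) auto
  next
    case False
    then show ?thesis using that H'(2) W by simp
  qed
  then show "poly_map m H'" by (simp add: poly_map_def)
  have HG: "subst (H' i) G = Var i" if "i < n" for i
  proof -
    have "subst (H' i) G = subst (H i) (\<lambda>j. subst (?S j) G)"
      unfolding H'(1)[OF that] by (rule subst_subst)
    also have "\<dots> = subst (H i) F"
      by (rule subst_cong) (use vH[OF that] G Wn in simp)
    finally show ?thesis using HF[OF that] by simp
  qed
  show "subst (H' i) G = Var i" if "i < m" for i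
    using HG WG[of i] H'(2)[of i] that by (cases "i < n") auto
  show "subst (G i) H' = Var i" if "i < m" for i
  proof (cases "i < n")
    case True
    have "subst (F i) H' = subst (F i) (\<lambda>j. subst (H j) ?S)"
      by (rule subst_cong) (use vF[OF True] H'(1) in simp)
    also have "\<dots> = subst (subst (F i) H) ?S" by (rule subst_subst[symmetric])
    also have "\<dots> = Var i + Const (lam i) * W n ^ 3" by (simp add: FH[OF True])
    finally show ?thesis by (simp add: G[OF True] H'(2))
  next
    case False
    then show ?thesis using GW that by simp
  qed
qed

text \<open>\<open>R\<close> sets the variables from \<open>n\<close> on to zero. \<open>G\<close>
  and \<open>H'\<close> both preserve this subspace, and \<open>G\<close> acts on it as
  \<open>F\<close>, so the restriction of \<open>H'\<close> inverts \<open>F\<close>.\<close>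

lemma invertible_restrict:
  fixes F :: "nat \<Rightarrow> 'a::comm_ring_1 mpoly"
  assumes F: "poly_map n F" and nm: "n < m"
    and GH: "\<And>i. i < m \<Longrightarrow> subst (G i) H' = Var i" and HG: "\<And>i. i < m \<Longrightarrow> subst (H' i) G = Var i"
    and H': "poly_map m H'"
    and G: "\<And>i. i < n \<Longrightarrow> G i = F i - Const (lam i) * Var n ^ 3"
    and R: "R = (\<lambda>i. if i < n then Var i else 0)"
    and G0: "\<And>i. n \<le> i \<Longrightarrow> i < m \<Longrightarrow> subst (G i) R = 0"
    and H0: "\<And>i. n \<le> i \<Longrightarrow> i < m \<Longrightarrow> subst (H' i) R = 0"
  shows "invertible_pm n F"
  unfolding invertible_pm_def
proof (intro exI[of _ "\<lambda>i. subst (H' i) R"] conjI allI impI)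
  have vF: "\<And>i j. i < n \<Longrightarrow> j \<in> vars (F i) \<Longrightarrow> j < n" using F by (auto simp: poly_map_def)
  have vH: "\<And>i j. i < m \<Longrightarrow> j \<in> vars (H' i) \<Longrightarrow> j < m" using H' by (auto simp: poly_map_def)
  show "poly_map n (\<lambda>i. subst (H' i) R)"
    unfolding poly_map_def by (intro allI impI vars_subset_intros) (auto simp: R)
  fix i assume i: "i < n"
  have Hn: "subst (H' n) R = 0" using H0 nm by simp
  have "subst (F i) H' = Var i + Const (lam i) * H' n ^ 3"
    using GH[of i] i nm by (simp add: G algebra_simps)
  then have "subst (subst (F i) H') R = Var i"
    using i Hn by (simp add: R)
  then show "subst (F i) (\<lambda>i. subst (H' i) R) = Var i"
    by (simp add: subst_subst)
  have "subst (F i) R = F i" if "i < n" for i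
  proof -
    have "subst (F i) R = subst (F i) Var"
      by (rule subst_cong) (use vF[OF that] in \<open>auto simp: R\<close>)
    then show ?thesis by (simp add: subst_Var_id)
  qed
  then have GR: "subst (G j) R = subst (R j) F" if "j < m" for j
    using that G[of j] G0[of j] by (cases "j < n") (auto simp: R)
  have "subst (subst (H' i) R) F = subst (H' i) (\<lambda>j. subst (R j) F)" by (rule subst_subst)
  also have "\<dots> = subst (H' i) (\<lambda>j. subst (G j) R)"
    by (rule subst_cong) (use vH[of i] i nm GR in auto)
  also have "\<dots> = subst (subst (H' i) G) R" by (rule subst_subst[symmetric])
  also have "\<dots> = Var i" using HG[of i] i nm by (simp add: R)
  finally show "subst (subst (H' i) R) F = Var i" .
qed

context
  fixes F G :: "nat \<Rightarrow> 'a::comm_ring_1 mpoly" and n :: nat and lam :: "nat \<Rightarrow> 'a"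
  assumes F: "poly_map n F" and G: "\<And>i. i < n \<Longrightarrow> G i = F i - Const (lam i) * Var n ^ 3"
begin

lemma invertible_a:
  assumes Gn: "G n = Var n"
  shows "invertible_pm n F \<longleftrightarrow> invertible_pm (n + 1) G"
proof
  assume "invertible_pm n F"
  then obtain H where H: "poly_map n H" "\<And>i. i < n \<Longrightarrow> subst (F i) H = Var i" "\<And>i. i < n \<Longrightarrow> subst (H i) F = Var i"
    by (auto simp: invertible_pm_def)
  show "invertible_pm (n + 1) G"
    by (rule invertible_extend[OF F H _ G, where W = "Var" and
          H' = "\<lambda>i. if i < n then subst (H i) (\<lambda>j. Var j + Const (lam j) * Var n ^ 3) else Var i"])
      (auto simp: Gn le_Suc_eq less_Suc_eq)
next
  assume "invertible_pm (n + 1) G"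
  then obtain H where H: "poly_map (n + 1) H" "\<And>i. i < n + 1 \<Longrightarrow> subst (G i) H = Var i" "\<And>i. i < n + 1 \<Longrightarrow> subst (H i) G = Var i"
    by (auto simp: invertible_pm_def)
  have "H n = Var n" using H(2)[of n] by (simp add: Gn)
  then have *: "subst (H i) (\<lambda>i. if i < n then Var i else 0) = 0" "subst (G i) (\<lambda>i. if i < n then Var i else 0) = 0"
    if "n \<le> i" "i < n + 1" for i
    using that Gn by (auto simp: less_Suc_eq)
  show "invertible_pm n F"
    by (rule invertible_restrict[OF F _ H(2,3,1) G refl]) (use * in auto)
qed

lemma invertible_b:
  assumes Gn: "G n = Var n" "G (n + 1) = Var (n + 1) + Var n ^ 3"
  shows "invertible_pm n F \<longleftrightarrow> invertible_pm (n + 2) G"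
proof
  assume "invertible_pm n F"
  then obtain H where H: "poly_map n H" "\<And>i. i < n \<Longrightarrow> subst (F i) H = Var i" "\<And>i. i < n \<Longrightarrow> subst (H i) F = Var i"
    by (auto simp: invertible_pm_def)
  let ?W = "\<lambda>i. if i = n then Var n else Var (n + 1) - Var n ^ 3"
  show "invertible_pm (n + 2) G"
  proof (rule invertible_extend[OF F H _ G, where W = ?W and
          H' = "\<lambda>i. if i < n then subst (H i) (\<lambda>j. Var j + Const (lam j) * Var n ^ 3) else ?W i"])
    fix i assume i: "n \<le> i" "i < n + 2"
    show "vars (?W i) \<subseteq> {..<n + 2}"
      by (cases "i = n") (simp, simp, intro vars_subset_intros, simp_all)
    show "subst (G i) (\<lambda>i. if i < n then subst (H i) (\<lambda>j. Var j + Const (lam j) * Var n ^ 3) else ?W i) = Var i"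
      using i Gn less_add_2_cases[OF i(2)] by auto
    show "subst (?W i) G = Var i" using i Gn less_add_2_cases[OF i(2)] by auto
  qed (auto simp: Gn)
next
  assume "invertible_pm (n + 2) G"
  then obtain H where H: "poly_map (n + 2) H" "\<And>i. i < n + 2 \<Longrightarrow> subst (G i) H = Var i" "\<And>i. i < n + 2 \<Longrightarrow> subst (H i) G = Var i"
    by (auto simp: invertible_pm_def)
  have Hn: "H n = Var n" using H(2)[of n] by (simp add: Gn)
  have Hn1: "H (n + 1) = Var (n + 1) - Var n ^ 3"
    using H(2)[of "n + 1"] Gn(2) by (simp add: Hn algebra_simps)
  have *: "subst (H i) (\<lambda>i. if i < n then Var i else 0) = 0" "subst (G i) (\<lambda>i. if i < n then Var i else 0) = 0"
    if "n \<le> i" "i < n + 2" for i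
    using that less_add_2_cases[OF that(2)] Gn Hn Hn1 by auto
  show "invertible_pm n F"
    by (rule invertible_restrict[OF F _ H(2,3,1) G refl]) (use * in auto)
qed

lemma invertible_c:
  assumes Gn: "G n = Var (n + 1) - Const 3 * linform n lam * Var n ^ 2" "G (n + 1) = Var n"
  shows "invertible_pm n F \<longleftrightarrow> invertible_pm (n + 2) G"
proof
  assume "invertible_pm n F"
  then obtain H where H: "poly_map n H" "\<And>i. i < n \<Longrightarrow> subst (F i) H = Var i" "\<And>i. i < n \<Longrightarrow> subst (H i) F = Var i"
    by (auto simp: invertible_pm_def)
  \<comment> \<open>The old \<open>Var n\<close> is output \<open>n + 1\<close> of \<open>G\<close>.
    Hence \<open>H\<close> at \<open>S\<close> recovers the first \<open>n\<close> variables from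
    the outputs, and \<open>L\<close> recovers \<open>linform n lam\<close>, which is what undoing
    the quadratic factor in component \<open>n\<close> requires.\<close>
  define S where "S j = Var j + Const (lam j) * Var (n + 1) ^ 3" for j
  define L where "L = (\<Sum>j<n. Const (lam j) * subst (H j) S)"
  define W where "W i = (if i = n then Var (n + 1) else Var n + Const 3 * L * Var (n + 1) ^ 2)" for i
  define H' where "H' i = (if i < n then subst (H i) S else W i)" for i
  have L: "L = subst (linform n lam) H'"
    by (simp add: L_def linform_def H'_def)
  show "invertible_pm (n + 2) G"
  proof (rule invertible_extend[OF F H _ G, where W = W and H' = H'])
    show "subst (W n) G = Var n" by (simp add: W_def Gn[simplified])
    fix i
    show "H' i = subst (H i) (\<lambda>j. Var j + Const (lam j) * W n ^ 3)" if "i < n"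
      using that by (simp add: H'_def W_def S_def[abs_def])
    show "H' i = W i" if "n \<le> i" using that by (simp add: H'_def)
    assume i: "n \<le> i" "i < n + 2"
    have "vars L \<subseteq> {..<n + 2}"
    proof -
      have vS: "vars (subst (H j) S) \<subseteq> {..<n + 2}" if "j < n" for j
      proof (rule vars_subset_intros)
        fix k assume "k \<in> vars (H j)"
        then have "k < n" using H(1) that by (auto simp: poly_map_def)
        then show "vars (S k) \<subseteq> {..<n + 2}"
          unfolding S_def by (intro vars_subset_intros) auto
      qed
      then show ?thesis unfolding L_def by (intro vars_subset_intros(5) vars_subset_intros(3)) simp_all
    qed
    then show "vars (W i) \<subseteq> {..<n + 2}"
      by (cases "i = n") (simp add: W_def, simp add: W_def del: Const_numeral, intro vars_subset_intros, simp_all)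
    show "subst (G i) H' = Var i"
      using i less_add_2_cases[OF i(2)] by (auto simp: Gn[simplified] H'_def[of n] H'_def[of "Suc n"] W_def L)
    assume HG: "\<And>j. j < n \<Longrightarrow> subst (H' j) G = Var j"
    have "subst L G = linform n lam"
      unfolding L_def linform_def using HG by (auto simp: H'_def intro!: sum.cong)
    then show "subst (W i) G = Var i"
      using i less_add_2_cases[OF i(2)] by (auto simp: W_def Gn[simplified])
  qed auto
next
  assume "invertible_pm (n + 2) G"
  then obtain H where H: "poly_map (n + 2) H" "\<And>i. i < n + 2 \<Longrightarrow> subst (G i) H = Var i" "\<And>i. i < n + 2 \<Longrightarrow> subst (H i) G = Var i"
    by (auto simp: invertible_pm_def)
  have Hn: "H n = Var (n + 1)" using H(2)[of "n + 1"] by (simp add: Gn[simplified])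
  have Hn1: "H (n + 1) = Var n + 3 * subst (linform n lam) H * Var (n + 1) ^ 2"
    using H(2)[of n] by (simp add: Gn Hn algebra_simps)
  have *: "subst (H i) (\<lambda>i. if i < n then Var i else 0) = 0" "subst (G i) (\<lambda>i. if i < n then Var i else 0) = 0"
    if "n \<le> i" "i < n + 2" for i
    using that less_add_2_cases[OF that(2)] Gn Hn Hn1 by auto
  show "invertible_pm n F"
    by (rule invertible_restrict[OF F _ H(2,3,1) G refl]) (use * in auto)
qed

end

subsection \<open>Druzkowski maps\<close>

text \<open>The additional component is made for this purpose: adding \<open>\<mu> i\<close> times
  \<open>Var (n + 1) + Var n ^ 3\<close> to row \<open>i\<close> cancels the cubes brought in by
  \<open>lam\<close>, and the surplus \<open>\<mu> i\<close> times \<open>Var (n + 1)\<close> is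
  absorbed by the inverse coordinate change.\<close>

lemma lin_conj_druzkowski_b:
  fixes F G :: "nat \<Rightarrow> 'a::comm_ring_1 mpoly" and n :: nat and lam :: "nat \<Rightarrow> 'a"
  assumes F: "poly_map n F" and G: "\<And>i. i < n \<Longrightarrow> G i = F i - Const (lam i) * Var n ^ 3"
    and Gn: "G n = Var n" "G (n + 1) = Var (n + 1) + Var n ^ 3"
    and dru: "lin_conj_druzkowski n F"
  shows "lin_conj_druzkowski (n + 2) G"
proof -
  obtain T Ti A where TA: "T \<in> carrier_mat n n" "Ti \<in> carrier_mat n n" "A \<in> carrier_mat n n"
      "T * Ti = 1\<^sub>m n" "Ti * T = 1\<^sub>m n"
    and D: "\<And>i. i < n \<Longrightarrow> (\<Sum>j<n. Const (T $$ (i, j)) * subst (F j) (\<lambda>k. \<Sum>l<n. Const (Ti $$ (k, l)) * Var l))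
             = Var i + (\<Sum>j<n. Const (A $$ (i, j)) * Var j) ^ 3"
    using dru unfolding lin_conj_druzkowski_def by blast
  define \<mu> where "\<mu> i = (\<Sum>j<n. T $$ (i, j) * lam j)" for i
  have TTi: "(\<Sum>k<n. T $$ (i, k) * Ti $$ (k, j)) = (if i = j then 1 else 0)" if "i < n" "j < n" for i j
    using arg_cong[OF TA(4), of "\<lambda>M. M $$ (i, j)"] that TA(1,2)
    by (simp add: times_mat_def scalar_prod_def lessThan_atLeast0)
  have TiT: "(\<Sum>k<n. Ti $$ (i, k) * T $$ (k, j)) = (if i = j then 1 else 0)" if "i < n" "j < n" for i j
    using arg_cong[OF TA(5), of "\<lambda>M. M $$ (i, j)"] that TA(1,2)
    by (simp add: times_mat_def scalar_prod_def lessThan_atLeast0)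
  have Ti\<mu>: "(\<Sum>l<n. Ti $$ (k, l) * \<mu> l) = lam k" if "k < n" for k
  proof -
    have "(\<Sum>l<n. Ti $$ (k, l) * \<mu> l) = (\<Sum>j<n. (\<Sum>l<n. Ti $$ (k, l) * T $$ (l, j)) * lam j)"
      unfolding \<mu>_def sum_distrib_left sum_distrib_right mult.assoc by (rule sum.swap)
    also have "\<dots> = (\<Sum>j<n. if k = j then lam j else 0)"
      using that TiT by (intro sum.cong) auto
    finally show ?thesis using that by simp
  qed
  \<comment> \<open>Coordinate changes acting by \<open>M\<close> on the first \<open>n\<close>
    coordinates and adding multiples of coordinate \<open>n + 1\<close> to them.\<close>
  define ext :: "'a mat \<Rightarrow> (nat \<Rightarrow> 'a) \<Rightarrow> 'a mat" where
    "ext M v = mat (n + 2) (n + 2) (\<lambda>(i, j). if i < n then (if j < n then M $$ (i, j) else if j = n then 0 else v i)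
      else if i = j then 1 else 0)" for M v
  define T' where "T' = ext T \<mu>"
  define Ti' where "Ti' = ext Ti (\<lambda>i. - lam i)"
  \<comment> \<open>The last column \<open>- A \<mu>\<close> arises when \<open>Var l\<close> is
    replaced by \<open>V l\<close>. The entry \<open>1\<close> in row \<open>n + 1\<close> produces
    the cube of \<open>Var n\<close>, and row \<open>n\<close> is zero because that component is
    just \<open>Var n\<close>.\<close>
  define A' where "A' = mat (n + 2) (n + 2) (\<lambda>(i, j). if i < n then (if j < n then A $$ (i, j) else if j = n then 0
      else - (\<Sum>k<n. A $$ (i, k) * \<mu> k)) else if i = n + 1 \<and> j = n then 1 else 0)"
  have ext_mult: "ext M v * ext N u = 1\<^sub>m (n + 2)"
    if MN: "\<And>i j. i < n \<Longrightarrow> j < n \<Longrightarrow> (\<Sum>k<n. M $$ (i, k) * N $$ (k, j)) = (if i = j then 1 else 0)"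
      and uv: "\<And>i. i < n \<Longrightarrow> (\<Sum>k<n. M $$ (i, k) * u k) + v i = 0" for M N u v
  proof (rule eq_matI)
    fix i j assume "i < dim_row (1\<^sub>m (n + 2) :: 'a mat)" "j < dim_col (1\<^sub>m (n + 2) :: 'a mat)"
    then have ij: "i < n + 2" "j < n + 2" by auto
    have "(ext M v * ext N u) $$ (i, j) = (\<Sum>k<n + 2. ext M v $$ (i, k) * ext N u $$ (k, j))"
      using ij by (simp add: times_mat_def scalar_prod_def ext_def lessThan_atLeast0)
    also have "\<dots> = (if i = j then 1 else 0)"
      unfolding sum_lessThan_add2 using less_add_2_cases[OF ij(1)] less_add_2_cases[OF ij(2)] MN uv
      by (auto simp: ext_def)
    finally show "(ext M v * ext N u) $$ (i, j) = 1\<^sub>m (n + 2) $$ (i, j)"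
      using ij by simp
  qed (simp_all add: ext_def)
  define P where "P k = (\<Sum>l<n. Const (Ti $$ (k, l)) * Var l)" for k
  define Q where "Q k = (\<Sum>l<n + 2. Const (Ti' $$ (k, l)) * Var l)" for k
  have Q: "Q k = P k - Const (lam k) * Var (n + 1)" if "k < n" for k
    unfolding Q_def P_def sum_lessThan_add2 using that by (simp add: Ti'_def ext_def Const_uminus)
  have Qn: "Q n = Var n" "Q (n + 1) = Var (n + 1)"
    unfolding Q_def sum_lessThan_add2 by (simp_all add: Ti'_def ext_def)
  \<comment> \<open>A shear by \<open>- \<mu>\<close> times \<open>Var (n + 1)\<close>. As
    \<open>Ti\<close> maps \<open>\<mu>\<close> to \<open>lam\<close>, substituting \<open>V\<close>
    into \<open>P\<close> gives the first \<open>n\<close> components of the extended change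
    \<open>Q\<close>.\<close>
  define V where "V l = Var l - Const (\<mu> l) * Var (n + 1)" for l
  have PV: "subst (P k) V = Q k" if "k < n" for k
  proof -
    have "subst (P k) V = P k - (\<Sum>l<n. Const (Ti $$ (k, l) * \<mu> l) * Var (n + 1))"
      by (simp add: P_def V_def right_diff_distrib sum_subtractf Const_mult mult.assoc)
    also have "(\<Sum>l<n. Const (Ti $$ (k, l) * \<mu> l) * Var (n + 1)) = Const (lam k) * Var (n + 1)"
      by (simp only: Ti\<mu>[OF that, symmetric] Const_sum sum_distrib_right)
    finally show ?thesis by (simp add: Q[OF that])
  qed
  have FQ: "subst (F j) Q = subst (subst (F j) P) V" if j: "j < n" for j
  proof -
    have "subst (F j) Q = subst (F j) (\<lambda>i. subst (P i) V)"
    proof (rule subst_cong)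
      fix i assume "i \<in> vars (F j)"
      then have "i < n" using F j by (auto simp: poly_map_def)
      then show "Q i = subst (P i) V" by (rule PV[symmetric])
    qed
    then show ?thesis by (simp only: subst_subst)
  qed
  have main: "(\<Sum>j<n. Const (T $$ (i, j)) * subst (F j) Q)
      = V i + ((\<Sum>j<n. Const (A $$ (i, j)) * Var j) - (\<Sum>k<n. Const (A $$ (i, k) * \<mu> k) * Var (n + 1))) ^ 3"
    if "i < n" for i
  proof -
    have "(\<Sum>j<n. Const (T $$ (i, j)) * subst (F j) Q) = subst (\<Sum>j<n. Const (T $$ (i, j)) * subst (F j) P) V"
      by (simp add: FQ)
    also have "\<dots> = subst (Var i + (\<Sum>j<n. Const (A $$ (i, j)) * Var j) ^ 3) V"
      using D[OF that] by (simp add: P_def[abs_def])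
    finally show ?thesis
      by (simp add: V_def right_diff_distrib sum_subtractf Const_mult mult.assoc)
  qed
  have final: "(\<Sum>j<n + 2. Const (T' $$ (i, j)) * subst (G j) Q)
      = Var i + (\<Sum>j<n + 2. Const (A' $$ (i, j)) * Var j) ^ 3" if i: "i < n + 2" for i
  proof (cases "i < n")
    case True
    have A': "(\<Sum>j<n + 2. Const (A' $$ (i, j)) * Var j)
        = (\<Sum>j<n. Const (A $$ (i, j)) * Var j) - (\<Sum>k<n. Const (A $$ (i, k) * \<mu> k) * Var (n + 1))"
      unfolding sum_lessThan_add2 using True by (simp add: A'_def Const_uminus Const_sum sum_distrib_right)
    have "(\<Sum>j<n + 2. Const (T' $$ (i, j)) * subst (G j) Q)
        = (\<Sum>j<n. Const (T $$ (i, j)) * subst (G j) Q) + Const (\<mu> i) * (Var (n + 1) + Var n ^ 3)"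
      unfolding sum_lessThan_add2 using True Gn Qn by (simp add: T'_def ext_def)
    also have "(\<Sum>j<n. Const (T $$ (i, j)) * subst (G j) Q)
        = (\<Sum>j<n. Const (T $$ (i, j)) * subst (F j) Q) - (\<Sum>j<n. Const (T $$ (i, j) * lam j) * Var n ^ 3)"
      using Qn by (simp add: G right_diff_distrib sum_subtractf Const_mult mult.assoc)
    also have "(\<Sum>j<n. Const (T $$ (i, j) * lam j) * Var n ^ 3) = Const (\<mu> i) * Var n ^ 3"
      by (simp only: \<mu>_def Const_sum sum_distrib_right)
    finally show ?thesis
      unfolding main[OF True] A' by (simp add: V_def algebra_simps)
  next
    case False
    then consider "i = n" | "i = n + 1" using i by linarith
    then show ?thesis
      unfolding sum_lessThan_add2
      by cases (use Gn Qn in \<open>simp_all add: T'_def A'_def ext_def\<close>)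
  qed
  show ?thesis
    unfolding lin_conj_druzkowski_def
  proof (rule exI[of _ T'], rule exI[of _ Ti'], rule exI[of _ A'], intro conjI allI impI)
    show "T' * Ti' = 1\<^sub>m (n + 2)" unfolding T'_def Ti'_def
      by (rule ext_mult) (simp_all add: TTi \<mu>_def sum_negf)
    show "Ti' * T' = 1\<^sub>m (n + 2)" unfolding T'_def Ti'_def
      by (rule ext_mult) (simp_all add: TiT Ti\<mu>)
    show "(\<Sum>j<n + 2. Const (T' $$ (i, j)) * subst (G j) (\<lambda>k. \<Sum>l<n + 2. Const (Ti' $$ (k, l)) * Var l))
      = Var i + (\<Sum>j<n + 2. Const (A' $$ (i, j)) * Var j) ^ 3" if "i < n + 2" for i
      using final[OF that] by (simp add: Q_def[abs_def])
  qed (simp_all add: T'_def Ti'_def A'_def ext_def)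
qed

subsection \<open>The theorem\<close>

theorem theorem3p1:
  fixes F :: "nat \<Rightarrow> 'a::field_char_0 mpoly" and n :: nat
  assumes "keller n F" and "cubic_no_quad n F"
  shows "\<exists>lam :: nat \<Rightarrow> 'a.
    (let xl = (\<Sum>i<n. Const (lam i) * Var i);
         Ga = (\<lambda>i. if i < n then F i - Const (lam i) * Var n ^ 3
                   else if i = n then Var n else 0);
         Gb = (\<lambda>i. if i < n then F i - Const (lam i) * Var n ^ 3
                   else if i = n then Var n
                   else if i = n + 1 then Var (n + 1) + Var n ^ 3 else 0);
         Gc = (\<lambda>i. if i < n then F i - Const (lam i) * Var n ^ 3
                   else if i = n then Var (n + 1) - Const 3 * xl * Var n ^ 2
                   else if i = n + 1 then Var n else 0)
     in (\<forall>i<n + 2. Gc i = (if i < n then F i else 0)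
                           + pdiff i (Var n * Var (n + 1) - xl * Var n ^ 3)) \<and>
        lincomb_prop (n + 1) Ga \<and> keller (n + 1) Ga \<and> cubic_no_quad (n + 1) Ga \<and>
          (invertible_pm n F \<longleftrightarrow> invertible_pm (n + 1) Ga) \<and>
        lincomb_prop (n + 2) Gb \<and> keller (n + 2) Gb \<and> cubic_no_quad (n + 2) Gb \<and>
          (invertible_pm n F \<longleftrightarrow> invertible_pm (n + 2) Gb) \<and>
        lincomb_prop (n + 2) Gc \<and> keller (n + 2) Gc \<and> cubic_no_quad (n + 2) Gc \<and>
          (invertible_pm n F \<longleftrightarrow> invertible_pm (n + 2) Gc) \<and>
        (lin_conj_druzkowski n F \<longrightarrow> lin_conj_druzkowski (n + 2) Gb) \<and>
        (jac_symmetric n F \<longrightarrow> jac_symmetric (n + 2) Gc))"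
proof -
  obtain lam where lam: "\<And>c0 c b. reducible (Const c0 + (\<Sum>i<n. Const (c i) * (F i - Const (lam i) * Var n ^ 3)) + Const b * Var n) \<Longrightarrow>
     \<exists>a. Const c0 + (\<Sum>i<n. Const (c i) * (F i - Const (lam i) * Var n ^ 3)) + Const b * Var n = Const a"
    using keller_cubic_exists_lam[OF assms] by blast
  obtain d where d: "d \<noteq> 0" "det (jac n F) = Const d" using assms(1) by (auto simp: keller_def)
  have pF: "poly_map n F" using assms(1) by (simp add: keller_def)
  have vF: "vars (F i) \<subseteq> {..<n}" if "i < n" for i using pF that by (simp add: poly_map_def)
  have cF: "cubic_linear (F i)" if "i < n" for i using assms(2) that by (simp add: cubic_no_quad_def cubic_linear_def)
  have cubic_linear_iff: "cubic_no_quad m G \<longleftrightarrow> (\<forall>i<m. cubic_linear (G i))" for m and G :: "nat \<Rightarrow> 'a mpoly"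
    by (auto simp: cubic_no_quad_def cubic_linear_def)
  define xl where "xl = linform n lam"
  have vxl: "vars xl \<subseteq> {..<n}" unfolding xl_def by (rule vars_linform)
  have pxl: "pdiff j xl = (if j < n then Const (lam j) else 0)" for j
    unfolding xl_def by (rule pdiff_linform)
  define E where "E i = F i - Const (lam i) * Var n ^ 3" for i
  have cE: "cubic_linear (E i)" if "i < n" for i
    unfolding E_def by (intro cubic_linear_diff cF cubic_linear_smult_cube that)
  have vE: "vars (E i) \<subseteq> {..<m}" if "i < n" "n < m" for i m
  proof -
    have "vars (F i) \<subseteq> {..<m}" using vF[OF that(1)] that(2) by auto
    then show ?thesis unfolding E_def using that by (intro vars_subset_intros) auto
  qed
  have lamE: "\<exists>a. Const c0 + (\<Sum>i<n. Const (c i) * E i) + Const b * Var n = Const a"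
    if "reducible (Const c0 + (\<Sum>i<n. Const (c i) * E i) + Const b * Var n)" for c0 c b
    using lam that unfolding E_def by blast
  define Ga where "Ga i = (if i < n then E i else if i = n then Var n else 0)" for i
  define Gb where "Gb i = (if i < n then E i else if i = n then Var n
      else if i = n + 1 then Var (n + 1) + Var n ^ 3 else 0)" for i
  define Gc where "Gc i = (if i < n then E i else if i = n then Var (n + 1) - Const 3 * xl * Var n ^ 2
      else if i = n + 1 then Var n else 0)" for i
  have Ga: "\<And>i. i < n \<Longrightarrow> Ga i = F i - Const (lam i) * Var n ^ 3" "Ga n = Var n"
    by (simp_all add: Ga_def E_def)
  have Gb: "\<And>i. i < n \<Longrightarrow> Gb i = F i - Const (lam i) * Var n ^ 3" "Gb n = Var n"
      "Gb (n + 1) = Var (n + 1) + Var n ^ 3"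
    by (simp_all add: Gb_def E_def)
  have Gc: "\<And>i. i < n \<Longrightarrow> Gc i = F i - Const (lam i) * Var n ^ 3"
      "Gc n = Var (n + 1) - Const 3 * linform n lam * Var n ^ 2" "Gc (n + 1) = Var n"
    by (simp_all add: Gc_def E_def xl_def)
  have grad: "Gc i = (if i < n then F i else 0) + pdiff i (Var n * Var (n + 1) - xl * Var n ^ 3)"
    if "i < n + 2" for i
    using less_add_2_cases[OF that] by (auto simp: Gc_def E_def pxl pdiff_power)
  have nv: "n + 1 \<notin> vars (Const c0 + (\<Sum>i<n. Const (c i) * E i) + p)" if "vars p \<subseteq> {..<n + 1}" for c0 c p
  proof -
    have "vars (Const c0 + (\<Sum>i<n. Const (c i) * E i) + p) \<subseteq> {..<n + 1}"
      using that vE by (intro vars_subset_intros) auto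
    then show ?thesis by auto
  qed
  have lin_a: "lincomb_prop (n + 1) Ga"
    unfolding lincomb_prop_def
  proof (intro allI impI)
    fix c0 c assume "reducible (Const c0 + (\<Sum>i<n + 1. Const (c i) * Ga i))"
    moreover have "Const c0 + (\<Sum>i<n + 1. Const (c i) * Ga i)
        = Const c0 + (\<Sum>i<n. Const (c i) * E i) + Const (c n) * Var n"
      by (simp add: Ga_def add.assoc)
    ultimately show "\<exists>a. Const c0 + (\<Sum>i<n + 1. Const (c i) * Ga i) = Const a"
      using lamE[of c0 c "c n"] by (simp only:)
  qed
  have lin_b: "lincomb_prop (n + 2) Gb"
    unfolding lincomb_prop_def
  proof (intro allI impI)
    fix c0 c assume red: "reducible (Const c0 + (\<Sum>i<n + 2. Const (c i) * Gb i))"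
    have eq: "Const c0 + (\<Sum>i<n + 2. Const (c i) * Gb i) = Const (c (n + 1)) * Var (n + 1)
        + (Const c0 + (\<Sum>i<n. Const (c i) * E i) + (Const (c n) * Var n + Const (c (n + 1)) * Var n ^ 3))"
      unfolding sum_lessThan_add2 by (simp add: Gb_def algebra_simps)
    have "n + 1 \<notin> vars (Const c0 + (\<Sum>i<n. Const (c i) * E i) + (Const (c n) * Var n + Const (c (n + 1)) * Var n ^ 3))"
      by (rule nv) (intro vars_subset_intros, auto)
    \<comment> \<open>A nonzero coefficient of \<open>Var (n + 1)\<close> would make the combination
      irreducible; without it, a combination for map (a) remains.\<close>
    from not_reducible_linear_in_var[OF _ this] red have "c (n + 1) = 0"
      unfolding eq by blast
    then have "Const c0 + (\<Sum>i<n + 2. Const (c i) * Gb i)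
        = Const c0 + (\<Sum>i<n. Const (c i) * E i) + Const (c n) * Var n"
      unfolding eq by (simp add: add.assoc)
    with red show "\<exists>a. Const c0 + (\<Sum>i<n + 2. Const (c i) * Gb i) = Const a"
      using lamE[of c0 c "c n"] by (simp only:)
  qed
  have lin_c: "lincomb_prop (n + 2) Gc"
    unfolding lincomb_prop_def
  proof (intro allI impI)
    fix c0 c assume red: "reducible (Const c0 + (\<Sum>i<n + 2. Const (c i) * Gc i))"
    have eq: "Const c0 + (\<Sum>i<n + 2. Const (c i) * Gc i) = Const (c n) * Var (n + 1)
        + (Const c0 + (\<Sum>i<n. Const (c i) * E i) + (Const (c (n + 1)) * Var n - Const (c n) * (Const 3 * xl * Var n ^ 2)))"
      unfolding sum_lessThan_add2 by (simp add: Gc_def algebra_simps)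
    have "n + 1 \<notin> vars (Const c0 + (\<Sum>i<n. Const (c i) * E i) + (Const (c (n + 1)) * Var n - Const (c n) * (Const 3 * xl * Var n ^ 2)))"
      by (rule nv) (use vxl in \<open>intro vars_subset_intros, auto\<close>)
    \<comment> \<open>In (c) the coefficient of \<open>Var (n + 1)\<close> is \<open>c n\<close>.
      Its vanishing also removes the term with \<open>xl\<close>, and \<open>c (n + 1)\<close>
      becomes the coefficient of \<open>Var n\<close>.\<close>
    from not_reducible_linear_in_var[OF _ this] red have "c n = 0"
      unfolding eq by blast
    then have "Const c0 + (\<Sum>i<n + 2. Const (c i) * Gc i)
        = Const c0 + (\<Sum>i<n. Const (c i) * E i) + Const (c (n + 1)) * Var n"
      unfolding eq by (simp add: add.assoc)
    with red show "\<exists>a. Const c0 + (\<Sum>i<n + 2. Const (c i) * Gc i) = Const a"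
      using lamE[of c0 c "c (n + 1)"] by (simp only:)
  qed
  have kellerI: "keller m G" if "poly_map m G" "det (jac m G) = Const e" "e \<noteq> 0" for m G and e :: 'a
    unfolding keller_def by (intro conjI exI[of _ e] that)
  have "poly_map (n + 1) Ga"
    unfolding poly_map_def Ga_def using vE by (auto simp: subset_iff)
  then have kel_a: "keller (n + 1) Ga"
    by (rule kellerI[OF _ trans[OF det_jac_a[OF assms(1) Ga] d(2)] d(1)])
  have "poly_map (n + 2) Gb"
    unfolding poly_map_def
  proof (intro allI impI)
    fix i assume "i < n + 2"
    from less_add_2_cases[OF this] show "vars (Gb i) \<subseteq> {..<n + 2}"
      by (elim disjE) (simp add: Gb_def vE, simp add: Gb_def, simp add: Gb_def, intro vars_subset_intros, simp_all)
  qed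
  then have kel_b: "keller (n + 2) Gb"
    by (rule kellerI[OF _ trans[OF det_jac_b[OF assms(1) Gb] d(2)] d(1)])
  have "poly_map (n + 2) Gc"
    unfolding poly_map_def
  proof (intro allI impI)
    fix i assume "i < n + 2"
    have "vars (Var (n + 1) - Const 3 * xl * Var n ^ 2) \<subseteq> {..<n + 2}"
      using vxl by (intro vars_subset_intros) auto
    with less_add_2_cases[OF \<open>i < n + 2\<close>] show "vars (Gc i) \<subseteq> {..<n + 2}"
      by (elim disjE) (simp_all add: Gc_def vE)
  qed
  moreover have "det (jac (n + 2) Gc) = Const (- d)"
    using det_jac_c[OF assms(1) Gc] d(2) by (simp add: Const_uminus)
  ultimately have kel_c: "keller (n + 2) Gc"
    by (rule kellerI) (simp add: d(1))
  have cub_a: "cubic_no_quad (n + 1) Ga"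
    unfolding cubic_linear_iff Ga_def by (auto simp: cE cubic_linear_Var)
  have cub_b: "cubic_no_quad (n + 2) Gb"
    unfolding cubic_linear_iff Gb_def by (auto simp: cE cubic_linear_Var intro!: cubic_linear_add cubic_linear_cube)
  have cub_c: "cubic_no_quad (n + 2) Gc"
    unfolding cubic_linear_iff Gc_def xl_def
    by (auto simp: cE cubic_linear_Var simp del: Const_numeral intro!: cubic_linear_diff cubic_linear_linform_square)
  have sym: "jac_symmetric (n + 2) Gc" if "jac_symmetric n F"
    unfolding jac_symmetric_def
  proof (intro allI impI)
    \<comment> \<open>\<open>F\<close> is free of the two new variables, so mixed second derivatives
      of the potential in \<open>grad\<close> account for all entries with an index at least
      \<open>n\<close>, and those are symmetric.\<close>
    have pF0: "pdiff j (F i) = 0" if "i < n" "j \<ge> n" for i j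
      using that by (rule keller_pdiff_eq_0[OF assms(1)])
    fix i j assume ij: "i < n + 2" "j < n + 2"
    show "pdiff j (Gc i) = pdiff i (Gc j)"
      using less_add_2_cases[OF ij(1)] less_add_2_cases[OF ij(2)] that
      by (auto simp: Gc_def E_def pxl pF0 pdiff_power jac_symmetric_def algebra_simps)
  qed
  have inv_a: "invertible_pm n F \<longleftrightarrow> invertible_pm (n + 1) Ga"
    by (rule invertible_a[where lam = lam]) (intro pF Ga, assumption?)+
  have inv_b: "invertible_pm n F \<longleftrightarrow> invertible_pm (n + 2) Gb"
    by (rule invertible_b[where lam = lam]) (intro pF Gb, assumption?)+
  have inv_c: "invertible_pm n F \<longleftrightarrow> invertible_pm (n + 2) Gc"
    by (rule invertible_c[where lam = lam]) (intro pF Gc, assumption?)+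
  have dru: "lin_conj_druzkowski (n + 2) Gb" if "lin_conj_druzkowski n F"
    by (rule lin_conj_druzkowski_b[where F = F and lam = lam]) (intro pF Gb that, assumption?)+
  have xl: "(\<Sum>i<n. Const (lam i) * Var i) = xl" by (simp add: xl_def linform_def)
  have Ga_eq: "(\<lambda>i. if i < n then F i - Const (lam i) * Var n ^ 3 else if i = n then Var n else 0) = Ga"
    by (rule ext) (simp add: Ga_def E_def)
  have Gb_eq: "(\<lambda>i. if i < n then F i - Const (lam i) * Var n ^ 3 else if i = n then Var n
      else if i = n + 1 then Var (n + 1) + Var n ^ 3 else 0) = Gb"
    by (rule ext) (simp add: Gb_def E_def)
  have Gc_eq: "(\<lambda>i. if i < n then F i - Const (lam i) * Var n ^ 3
      else if i = n then Var (n + 1) - Const 3 * xl * Var n ^ 2 else if i = n + 1 then Var n else 0) = Gc"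
    by (rule ext) (simp add: Gc_def E_def)
  show ?thesis
    unfolding Let_def
    by (rule exI[of _ lam], unfold xl Ga_eq Gb_eq Gc_eq, intro conjI allI impI)
      (fact lin_a lin_b lin_c kel_a kel_b kel_c cub_a cub_b cub_c
        inv_a inv_b inv_c
        | (rule grad[unfolded Gc_def E_def] dru sym; assumption))+
qed

end
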